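(* Let $d\ge 1$ and let $J=J(\{A_n\},\{B_n\})$ be a block Jacobi matrix with $d\times d$ entries. Assume that: (1) $\lim_{k\to\infty}B_{2k-1}=+\infty$; (2) $\lim_{k\to\infty}(B_{2k}^{-1})_\oplus=0$; (3) one has $$\limsup_{n\to+\infty}\big\|(B_{2n}^{-1/2})_\oplus\, A_{2n-1}^*\, B_{2n-1}^{-1/2}\big\|+\limsup_{n\to+\infty}\big\|(B_{2n-2}^{-1/2})_\oplus\, A_{2n-2}\, B_{2n-1}^{-1/2}\big\|<1 .$$ Then the part of the spectrum $\sigma(J)\cap(0,+\infty)$ is discrete.
   Context: $\mathcal{M}_{d,d}(\mathbb{C})$ is the algebra of $d\times d$ complex matrices, $I_d$ the identity matrix, $\mathbb{N}=\{1,2,\dots\}$, and $\ell^2_d=\ell^2(\mathbb{N};\mathbb{C}^d)$. A block Jacobi matrix $J=J(\{A_n\},\{B_n\})$ is the semi-infinite block tridiagonal matrix with diagonal blocks $B_1,B_2,\dots$, superdiagonal blocks $A_1,A_2,\dots$ and subdiagonal blocks $A_1^*,A_2^*,\dots$; that is, $(Ju)_1=B_1u_1+A_1u_2$ and $(Ju)_n=A_{n-1}^*u_{n-1}+B_nu_n+A_nu_{n+1}$ for $n\ge2$, where $A_j,B_j\in\mathcal{M}_{d,d}(\mathbb{C})$, $B_j=B_j^*$ and $A_j$ is invertible for all $j$. $J_{min}$ is the symmetric operator in $\ell^2_d$ given by $J$ on the domain of finitely supported sequences. Standing assumption: the two defect (deficiency) numbers of $J_{min}$ are equal, so that $J_{min}$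 admits self-adjoint extensions; an arbitrary self-adjoint extension is fixed and also denoted by $J$. For a sequence of Hermitian matrices $\{C_n\}$, $\lim_{n\to\infty}C_n=+\infty$ means: for any $M\ge 0$ there is $N=N(M)$ such that $C_n\ge M I_d$ for $n\ge N$. In particular $B_{2n-1}$ is positive definite for large $n$, so $B_{2n-1}^{-1/2}$ is defined for large $n$. For Hermitian $B\in\mathcal{M}_{d,d}(\mathbb{C})$, $B_+=B\,P_{(0,+\infty)}$ where $P_{(0,+\infty)}$ is the spectral projection of $B$ on $(0,+\infty)$. The matrix $(B^{-1})_\oplus$ is defined (also for non-invertible $B$) as $(B_+)^{-1}$ on the range $\mathrm{Im}(B_+)$ and $0$ on $\mathrm{Im}(B_+)^\perp$; and $(B^{-1/2})_\oplus:=\big((B^{-1})_\oplus\big)^{1/2}$. The part of the spectrum in $(0,+\infty)$ is discrete if it consists of isolated eigenvalues of finite multiplicity. *)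

theory Defs
  imports "HOL-Analysis.Analysis" "HOL-Library.Function_Algebras"
begin

section \<open>Hermitian matrices\<close>

definition cinner :: "complex^'d \<Rightarrow> complex^'d \<Rightarrow> complex" where
  "cinner x y = (\<Sum>i\<in>UNIV. x $ i * cnj (y $ i))"

definition conj_transpose :: "complex^'n^'m \<Rightarrow> complex^'m^'n" where
  "conj_transpose M = map_matrix cnj (transpose M)"

definition hermitian :: "complex^'d^'d \<Rightarrow> bool" where
  "hermitian M \<longleftrightarrow> conj_transpose M = M"

definition pos_semidef :: "complex^'d^'d \<Rightarrow> bool" where
  "pos_semidef M \<longleftrightarrow> hermitian M \<and> (\<forall>x. 0 \<le> Re (cinner (M *v x) x))"

definition matrix_norm :: "complex^'n^'m \<Rightarrow> real" where
  "matrix_norm M = onorm ((*v) M)"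

definition psd_sqrt :: "complex^'d^'d \<Rightarrow> complex^'d^'d" where
  "psd_sqrt M = (THE S. pos_semidef S \<and> S ** S = M)"

definition inv_sqrt :: "complex^'d^'d \<Rightarrow> complex^'d^'d" where
  "inv_sqrt M = psd_sqrt (matrix_inv M)"

definition tends_to_pinfty :: "(nat \<Rightarrow> complex^'d^'d) \<Rightarrow> bool" where
  "tends_to_pinfty C \<longleftrightarrow>
     (\<forall>M::real. M \<ge> 0 \<longrightarrow> (\<exists>N. \<forall>n\<ge>N. pos_semidef (C n - mat (complex_of_real M))))"

definition mat_eigenspace :: "complex^'d^'d \<Rightarrow> complex \<Rightarrow> (complex^'d) set" where
  "mat_eigenspace M z = {x. M *v x = z *s x}"

definition orth_proj :: "(complex^'d) set \<Rightarrow> complex^'d^'d" where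
  "orth_proj V = (THE P. hermitian P \<and> P ** P = P \<and> range ((*v) P) = V)"

text \<open>For Hermitian matrices all eigenvalues are real; the sum ranges over the finitely many
  eigenvalues lying in the set.\<close>

definition spectral_proj :: "complex^'d^'d \<Rightarrow> real set \<Rightarrow> complex^'d^'d" where
  "spectral_proj M S =
     (\<Sum>r \<in> {r \<in> S. mat_eigenspace M (complex_of_real r) \<noteq> {0}}.
        orth_proj (mat_eigenspace M (complex_of_real r)))"

definition pos_part :: "complex^'d^'d \<Rightarrow> complex^'d^'d" where
  "pos_part M = M ** spectral_proj M {0<..}"

text \<open>\<open>(M\<^sup>-\<^sup>1)\<^sub>\<oplus>\<close>: the inverse of \<open>M\<^sub>+\<close>, regarded as a bijection of its own range, extended by zero
  to the orthogonal complement of that range.\<close>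

definition pos_inv :: "complex^'d^'d \<Rightarrow> complex^'d^'d" where
  "pos_inv M = (THE G.
     (\<forall>y \<in> range ((*v) (pos_part M)).
        G *v y \<in> range ((*v) (pos_part M)) \<and> pos_part M *v (G *v y) = y) \<and>
     (\<forall>x. (\<forall>y \<in> range ((*v) (pos_part M)). cinner x y = 0) \<longrightarrow> G *v x = 0))"

definition pos_inv_sqrt :: "complex^'d^'d \<Rightarrow> complex^'d^'d" where
  "pos_inv_sqrt M = psd_sqrt (pos_inv M)"


section \<open>The Hilbert space of square-summable sequences of vectors\<close>

text \<open>The index set is \<open>{1, 2, \<dots>}\<close>. A sequence indexed by it is represented by a function on
  \<^typ>\<open>nat\<close> that vanishes at \<open>0\<close>.\<close>

definition l2 :: "(nat \<Rightarrow> complex^'d) set" where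
  "l2 = {u. u 0 = 0 \<and> summable (\<lambda>n. (norm (u n))\<^sup>2)}"

definition l2_inner :: "(nat \<Rightarrow> complex^'d) \<Rightarrow> (nat \<Rightarrow> complex^'d) \<Rightarrow> complex" where
  "l2_inner u v = (\<Sum>n. cinner (u n) (v n))"

definition l2_norm :: "(nat \<Rightarrow> complex^'d) \<Rightarrow> real" where
  "l2_norm u = sqrt (\<Sum>n. (norm (u n))\<^sup>2)"

definition seq_scale :: "complex \<Rightarrow> (nat \<Rightarrow> complex^'d) \<Rightarrow> (nat \<Rightarrow> complex^'d)" where
  "seq_scale c u = (\<lambda>n. c *s u n)"

interpretation vseq: vector_space seq_scale
  by unfold_locales (auto simp: seq_scale_def fun_eq_iff vec_eq_iff algebra_simps)


section \<open>Unbounded operators\<close>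

text \<open>An operator in \<^term>\<open>l2\<close> is identified with its graph, so its domain is \<^term>\<open>Domain T\<close>, and
  \<open>T\<close> extends \<open>S\<close> iff \<open>S \<subseteq> T\<close>.\<close>

type_synonym 'd seq_op = "((nat \<Rightarrow> complex^'d) \<times> (nat \<Rightarrow> complex^'d)) set"

definition linear_operator :: "'d::finite seq_op \<Rightarrow> bool" where
  "linear_operator T \<longleftrightarrow>
     T \<subseteq> l2 \<times> l2 \<and> single_valued T \<and> (0, 0) \<in> T \<and>
     (\<forall>u f v g. (u, f) \<in> T \<longrightarrow> (v, g) \<in> T \<longrightarrow> (u + v, f + g) \<in> T) \<and>
     (\<forall>c u f. (u, f) \<in> T \<longrightarrow> (seq_scale c u, seq_scale c f) \<in> T)"

definition densely_defined :: "'d::finite seq_op \<Rightarrow> bool" where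
  "densely_defined T \<longleftrightarrow> (\<forall>u\<in>l2. \<forall>e>0. \<exists>v\<in>Domain T. l2_norm (u - v) < e)"

definition op_adjoint :: "'d::finite seq_op \<Rightarrow> 'd seq_op" where
  "op_adjoint T = {(v, g). v \<in> l2 \<and> g \<in> l2 \<and> (\<forall>(u, f) \<in> T. l2_inner f v = l2_inner u g)}"

definition self_adjoint :: "'d::finite seq_op \<Rightarrow> bool" where
  "self_adjoint T \<longleftrightarrow> linear_operator T \<and> densely_defined T \<and> op_adjoint T = T"

definition op_eigenspace :: "'d::finite seq_op \<Rightarrow> complex \<Rightarrow> (nat \<Rightarrow> complex^'d) set" where
  "op_eigenspace T z = {u. (u, seq_scale z u) \<in> T}"

definition op_shift :: "'d::finite seq_op \<Rightarrow> complex \<Rightarrow> 'd seq_op" where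
  "op_shift T z = {(u, f - seq_scale z u) |u f. (u, f) \<in> T}"

definition resolvent_set :: "'d::finite seq_op \<Rightarrow> complex set" where
  "resolvent_set T = {z.
     (\<forall>f\<in>l2. \<exists>!u. (u, f) \<in> op_shift T z) \<and>
     (\<exists>C. \<forall>(u, f) \<in> op_shift T z. l2_norm u \<le> C * l2_norm f)}"

definition op_spectrum :: "'d::finite seq_op \<Rightarrow> complex set" where
  "op_spectrum T = - resolvent_set T"

definition discrete_spectrum_in :: "'d::finite seq_op \<Rightarrow> real set \<Rightarrow> bool" where
  "discrete_spectrum_in T S \<longleftrightarrow>
     (\<forall>z \<in> op_spectrum T \<inter> complex_of_real ` S.
        z isolated_in op_spectrum T \<and>
        op_eigenspace T z \<noteq> {0} \<and>
        (\<exists>F. finite F \<and> op_eigenspace T z \<subseteq> vseq.span F))"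

text \<open>The defect number of \<open>T\<close> at a non-real \<open>z\<close>. The library dimension is \<open>0\<close> on
  infinite-dimensional spaces; this case does not occur for the minimal block Jacobi operators
  below, since solutions of \<open>J u = z u\<close> are determined by \<open>u\<^sub>1\<close>.\<close>

definition defect_number :: "'d::finite seq_op \<Rightarrow> complex \<Rightarrow> nat" where
  "defect_number T z = vseq.dim (op_eigenspace (op_adjoint T) z)"


section \<open>Block Jacobi operators\<close>

text \<open>Only the blocks with index at least \<open>1\<close> are used.\<close>

definition jacobi ::
  "(nat \<Rightarrow> complex^'d^'d) \<Rightarrow> (nat \<Rightarrow> complex^'d^'d) \<Rightarrow> (nat \<Rightarrow> complex^'d) \<Rightarrow> nat \<Rightarrow> complex^'d" where
  "jacobi A B u n =
     (if n = 0 then 0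
      else if n = 1 then B 1 *v u 1 + A 1 *v u 2
      else conj_transpose (A (n - 1)) *v u (n - 1) + B n *v u n + A n *v u (n + 1))"

definition jacobi_min ::
  "(nat \<Rightarrow> complex^'d^'d) \<Rightarrow> (nat \<Rightarrow> complex^'d^'d) \<Rightarrow> 'd::finite seq_op" where
  "jacobi_min A B = {(u, jacobi A B u) |u. u 0 = 0 \<and> finite {n. u n \<noteq> 0}}"

end

theory Submission
  imports Defs
begin

text \<open>Fix \<open>r > 0\<close>, let \<open>P\<^sub>n\<close> be the projection onto the positive part of \<open>B\<^sub>n\<close>, and pair \<open>(J - r) v\<close>
  with \<open>(2 P - 1) v\<close> for finitely supported \<open>v\<close>. The couplings between positive and nonpositive parts
  cancel. The couplings among positive parts are dominated by \<open>a + b < 1\<close> times the positive diagonal form,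
  by the assumption on the norms; this form exceeds any multiple of \<open>\<parallel>P v\<parallel>\<^sup>2\<close> far out. Nonpositive
  parts, which live on even indices only, contribute at least \<open>r \<parallel>(1 - P) v\<parallel>\<^sup>2\<close>. Hence
  \<open>\<parallel>(J - r) v\<parallel> \<ge> r \<parallel>v\<parallel>\<close> if \<open>v\<close> vanishes up to a large index \<open>N\<close>.

  An extension of the minimal operator only adds finitely many dimensions, so that
  \<open>\<parallel>u\<parallel> \<le> C (\<parallel>(J - r) u\<parallel> + \<Sum>\<^sub>n\<^sub><\<^sub>M \<parallel>u\<^sub>n\<parallel>)\<close> on the whole domain. By compactness,
  \<open>J - r\<close> is bounded below on the orthogonal complement of its kernel, and self-adjointness turns this
  into invertibility of \<open>J - z\<close> for all \<open>z \<noteq> r\<close> near \<open>r\<close>. The eigenspace is finite-dimensional because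
  an eigenvector is determined by its first component.\<close>

subsection \<open>Hermitian matrices and the real inner product\<close>

text \<open>The minimal operator may have nonzero defect, so elements of the domain of
  \<open>J\<close> need not be graph limits of finitely supported sequences, and the tail estimate
  does not pass to the domain by approximation. Cutting off is no substitute, since the blocks
  \<open>A n\<close> may be unbounded. The tail estimate therefore acts only through the range it
  produces: \<open>J - r\<close> can be solved on the closure of that range, and whatever is
  orthogonal to the range obeys the recurrence.

  The bound r in the tail estimate comes from a balance. If p and q are the positive and nonpositive
  parts of v, the diagonal form supplies 2 r |p|^2, pairing r v with p - q costs r |p|^2 - r |q|^2,
  and r |v|^2 remains, while p - q has the norm of v. The sum a + b appears because every index has
  one neighbour coupled with constant a and one with constant b.

  Estimates and orthogonality use the real inner product throughout; complex scalars act as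
  additional real-linear maps.\<close>

lemma Re_cinner: "Re (cinner x y) = inner x y"
  by (simp add: cinner_def inner_vec_def inner_complex_def)

text \<open>Complex orthogonality thus amounts to real orthogonality to y and to \<i> y, which lets
  the real inner product serve everywhere.\<close>

lemma Im_cinner: "Im (cinner x y) = inner x (\<i> *s y)"
proof -
  have "Im (cinner x y) = Re (cinner x (\<i> *s y))"
    by (simp add: cinner_def algebra_simps sum_subtractf)
  then show ?thesis by (simp add: Re_cinner)
qed

lemma complex_of_real_scale_vec: "complex_of_real r *s x = r *\<^sub>R x"
  by (simp add: vec_eq_iff scaleR_conv_of_real[symmetric])

lemma matrix_vector_mult_scaleR_gen:
  fixes M :: "'a::real_algebra_1^'n^'m"
  shows "M *v (r *\<^sub>R x) = r *\<^sub>R (M *v x)"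
  using matrix_vector_mul_linear[of M] by (simp add: linear_iff)

lemma inner_complex_scale_left: "inner (c *s x) y = inner x (cnj c *s y)"
  for x y :: "complex^'d"
  by (simp add: inner_vec_def inner_complex_def algebra_simps sum.distrib sum_subtractf)

lemma inner_conj_transpose: "inner (M *v x) y = inner x (conj_transpose M *v y)"
  for M :: "complex^'n^'m"
proof -
  have "inner (M *v x) y = Re (\<Sum>i\<in>UNIV. \<Sum>j\<in>UNIV. M $ i $ j * x $ j * cnj (y $ i))"
    by (simp add: Re_cinner[symmetric] cinner_def matrix_vector_mult_def sum_distrib_right)
  also have "\<dots> = Re (\<Sum>j\<in>UNIV. \<Sum>i\<in>UNIV. M $ i $ j * x $ j * cnj (y $ i))"
    by (subst sum.swap) simp
  also have "\<dots> = inner x (conj_transpose M *v y)"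
    by (simp add: Re_cinner[symmetric] cinner_def matrix_vector_mult_def sum_distrib_left
        conj_transpose_def transpose_def map_matrix_def mult_ac)
  finally show ?thesis .
qed

lemma conj_transpose_conj_transpose: "conj_transpose (conj_transpose M) = M"
  by (simp add: conj_transpose_def transpose_def map_matrix_def vec_eq_iff)

lemma hermitian_iff_inner:
  "hermitian M \<longleftrightarrow> (\<forall>x y. inner (M *v x) y = inner x (M *v y))"
proof
  assume "\<forall>x y. inner (M *v x) y = inner x (M *v y)"
  then have "inner x (conj_transpose M *v y - M *v y) = 0" for x y
    by (simp add: inner_conj_transpose inner_diff_right)
  then have "conj_transpose M *v y = M *v y" for y
    by (metis inner_eq_zero_iff eq_iff_diff_eq_0)
  then show "hermitian M"
    by (simp add: hermitian_def matrix_eq)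
qed (metis hermitian_def inner_conj_transpose)

lemma hermitian_inner: "hermitian M \<Longrightarrow> inner (M *v x) y = inner x (M *v y)"
  using hermitian_iff_inner by blast

lemma pos_semidef_iff_inner:
  "pos_semidef M \<longleftrightarrow> hermitian M \<and> (\<forall>x. 0 \<le> inner (M *v x) x)"
  by (simp add: pos_semidef_def Re_cinner)

lemma vec_subspace_imp_subspace: "vec.subspace V \<Longrightarrow> subspace V"
  for V :: "(complex^'d) set"
  unfolding subspace_def vec.subspace_def
  by (metis complex_of_real_scale_vec)


subsection \<open>Orthogonal projections\<close>

text \<open>Equal ranges give P Q = Q and Q P = P; moving the Hermitian factors across the inner
  product identifies P and Q. This makes the definite description in \<open>orth_proj\<close>
  proper.\<close>

lemma hermitian_idempotent_range_unique:
  assumes "hermitian P" "P ** P = P" "hermitian Q" "Q ** Q = Q"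
    and "range ((*v) P) = range ((*v) Q)"
  shows "P = Q"
proof -
  have PQ: "P *v (Q *v x) = Q *v x" for x
    by (metis assms(2,5) matrix_vector_mul_assoc rangeE rangeI)
  have QP: "Q *v (P *v x) = P *v x" for x
    by (metis assms(4,5) matrix_vector_mul_assoc rangeE rangeI)
  have "inner (P *v x) y = inner (Q *v x) y" for x y
    by (metis PQ QP assms(1,3) hermitian_inner)
  then show ?thesis
    unfolding matrix_eq by (metis inner_eq_zero_iff eq_iff_diff_eq_0 inner_diff_left)
qed

text \<open>Decompose orthogonally with respect to V as a real subspace. The uniqueness of the foot
  point yields complex linearity: a scalar c moves across the real inner product as
  \<open>cnj c\<close>, and V is closed under it.\<close>

lemma orth_proj_exists:
  fixes V :: "(complex^'d) set"
  assumes V: "vec.subspace V"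
  shows "\<exists>P. hermitian P \<and> P ** P = P \<and> range ((*v) P) = V"
proof -
  have sV: "subspace V"
    using V by (rule vec_subspace_imp_subspace)
  have "\<exists>y. y \<in> V \<and> (\<forall>w\<in>V. inner (x - y) w = 0)" for x
    using orthogonal_subspace_decomp_exists[of V x] sV
    by (metis add_diff_cancel_left' orthogonal_def span_eq_iff)
  then obtain p where p: "\<And>x. p x \<in> V" "\<And>x w. w \<in> V \<Longrightarrow> inner (x - p x) w = 0"
    by metis
  have uniq: "p x = y" if "y \<in> V" "\<And>w. w \<in> V \<Longrightarrow> inner (x - y) w = 0" for x y
  proof -
    have "y - p x \<in> V"
      by (rule subspace_diff[OF sV that(1) p(1)])
    then have "inner (x - p x) (y - p x) = 0" "inner (x - y) (y - p x) = 0"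
      using that p by blast+
    then have "inner (y - p x) (y - p x) = 0"
      by (simp add: inner_diff_left)
    then show ?thesis by simp
  qed
  have lin: "Vector_Spaces.linear (*s) (*s) p"
  proof (unfold_locales)
    show "p (x + y) = p x + p y" for x y
    proof (rule uniq)
      show "p x + p y \<in> V"
        using sV p(1) p(1) by (rule subspace_add)
      fix w assume "w \<in> V"
      then have "inner (x - p x) w = 0" "inner (y - p y) w = 0"
        by (rule p)+
      then show "inner (x + y - (p x + p y)) w = 0"
        by (simp add: inner_add_left inner_diff_left)
    qed
    show "p (c *s x) = c *s p x" for c x
    proof (rule uniq)
      show "c *s p x \<in> V"
        by (rule vec.subspace_scale[OF V p(1)])
      fix w assume "w \<in> V"
      then have "cnj c *s w \<in> V"
        by (rule vec.subspace_scale[OF V])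
      then have "inner (x - p x) (cnj c *s w) = 0"
        by (rule p)
      then show "inner (c *s x - c *s p x) w = 0"
        by (metis inner_complex_scale_left vec.scale_right_diff_distrib)
    qed
  qed
  have P: "matrix p *v x = p x" for x
    using lin by (rule matrix_works)
  have id: "p y = y" if "y \<in> V" for y
    by (rule uniq) (use that in auto)
  have "inner (p x) y = inner x (p y)" for x y
    using p(2)[of "p y" x] p(2)[of "p x" y] p(1)
    by (simp add: inner_diff_left inner_diff_right inner_commute)
  then have "hermitian (matrix p)"
    by (simp add: hermitian_iff_inner P)
  moreover have "matrix p ** matrix p = matrix p"
    by (simp add: matrix_eq matrix_vector_mul_assoc[symmetric] P id p)
  moreover have "range ((*v) (matrix p)) = V"
    using p id by (auto simp: P image_iff) metis
  ultimately show ?thesis by blast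
qed

lemma orth_proj:
  assumes V: "vec.subspace V"
  shows hermitian_orth_proj: "hermitian (orth_proj V)"
    and orth_proj_idem: "orth_proj V ** orth_proj V = orth_proj V"
    and range_orth_proj: "range ((*v) (orth_proj V)) = V"
proof -
  have "\<exists>!P. hermitian P \<and> P ** P = P \<and> range ((*v) P) = V"
    using orth_proj_exists[OF V] hermitian_idempotent_range_unique by (metis (no_types, lifting))
  from theI'[OF this] show "hermitian (orth_proj V)" "orth_proj V ** orth_proj V = orth_proj V"
      "range ((*v) (orth_proj V)) = V"
    unfolding orth_proj_def by auto
qed

lemma orth_proj_in: "vec.subspace V \<Longrightarrow> orth_proj V *v x \<in> V"
  using range_orth_proj by blast

lemma orth_proj_id: "vec.subspace V \<Longrightarrow> x \<in> V \<Longrightarrow> orth_proj V *v x = x"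
  by (metis matrix_vector_mul_assoc orth_proj_idem range_orth_proj rangeE)

lemma orth_proj_zero:
  assumes "vec.subspace V" "\<And>y. y \<in> V \<Longrightarrow> inner x y = 0"
  shows "orth_proj V *v x = 0"
proof -
  have "inner (orth_proj V *v x) (orth_proj V *v x) = inner x (orth_proj V *v x)"
    by (metis assms(1) hermitian_inner hermitian_orth_proj matrix_vector_mul_assoc orth_proj_idem)
  then show ?thesis
    using assms orth_proj_in[OF assms(1)] by simp
qed


subsection \<open>The spectral theorem for Hermitian matrices\<close>

definition eigvals :: "complex^'d^'d \<Rightarrow> real set" where
  "eigvals M = {r. mat_eigenspace M (complex_of_real r) \<noteq> {0}}"

definition eigproj :: "complex^'d^'d \<Rightarrow> real \<Rightarrow> complex^'d^'d" where
  "eigproj M r = orth_proj (mat_eigenspace M (complex_of_real r))"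

lemma mem_mat_eigenspace_real:
  "x \<in> mat_eigenspace M (complex_of_real r) \<longleftrightarrow> M *v x = r *\<^sub>R x"
  by (simp add: mat_eigenspace_def complex_of_real_scale_vec)

lemma subspace_mat_eigenspace: "vec.subspace (mat_eigenspace M z)"
  unfolding vec.subspace_def mat_eigenspace_def
  by (auto simp: matrix_vector_right_distrib vec.scale_right_distrib vector_scalar_commute
      vec.scale_left_commute)

lemma mat_eigenspaces_orthogonal:
  assumes "hermitian M" "r \<noteq> s" "x \<in> mat_eigenspace M (complex_of_real r)"
    "y \<in> mat_eigenspace M (complex_of_real s)"
  shows "inner x y = 0"
proof -
  have "r * inner x y = s * inner x y"
    using hermitian_inner[OF assms(1), of x y] assms(3,4) by (simp add: mem_mat_eigenspace_real)
  then show ?thesis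
    using assms(2) by simp
qed

text \<open>Eigenvectors for distinct eigenvalues are orthogonal, hence independent in a
  finite-dimensional space.\<close>

lemma finite_eigvals:
  fixes M :: "complex^'d^'d"
  assumes "hermitian M"
  shows "finite (eigvals M)"
proof -
  have "\<exists>x. x \<noteq> 0 \<and> x \<in> mat_eigenspace M (complex_of_real r)" if "r \<in> eigvals M" for r
    using that vec.subspace_0[OF subspace_mat_eigenspace] unfolding eigvals_def by blast
  then obtain v where v: "\<And>r. r \<in> eigvals M \<Longrightarrow> v r \<noteq> 0 \<and> v r \<in> mat_eigenspace M (complex_of_real r)"
    by metis
  have inj: "inj_on v (eigvals M)"
    by (rule inj_onI) (metis assms inner_eq_zero_iff mat_eigenspaces_orthogonal v)
  have orth: "inner (v r) (v s) = 0" if "r \<in> eigvals M" "s \<in> eigvals M" "r \<noteq> s" for r s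
    using mat_eigenspaces_orthogonal[OF assms that(3)] v[OF that(1)] v[OF that(2)] by blast
  have "pairwise orthogonal (v ` eigvals M)"
    unfolding pairwise_def orthogonal_def by (intro ballI impI, elim imageE) (use orth in auto)
  moreover have "0 \<notin> v ` eigvals M"
  proof
    assume "0 \<in> v ` eigvals M"
    then obtain r where "r \<in> eigvals M" "v r = 0" by auto
    with v[of r] show False by blast
  qed
  ultimately have "independent (v ` eigvals M)"
    by (rule pairwise_orthogonal_independent)
  then show ?thesis
    using inj finite_imageD independent_imp_finite by blast
qed

text \<open>A maximiser of the quadratic form on the unit sphere of an invariant subspace is an
  eigenvector.\<close>

lemma hermitian_invariant_subspace_eigenvector:
  fixes M :: "complex^'d^'d"
  assumes M: "hermitian M" and V: "subspace V" "\<And>x. x \<in> V \<Longrightarrow> M *v x \<in> V" and "\<exists>x\<in>V. x \<noteq> 0"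
  shows "\<exists>r x. x \<in> V \<and> x \<noteq> 0 \<and> M *v x = r *\<^sub>R x"
proof -
  let ?S = "V \<inter> sphere 0 1"
  obtain x0 where "x0 \<in> V" "x0 \<noteq> 0" using assms by blast
  then have "x0 /\<^sub>R norm x0 \<in> ?S"
    using V(1) by (simp add: subspace_scale)
  then have ne: "?S \<noteq> {}" by blast
  have "compact ?S"
    using closed_subspace[OF V(1)] by (simp add: closed_Int_compact)
  moreover have "continuous_on ?S (\<lambda>x. inner (M *v x) x)"
    by (intro continuous_intros)
  ultimately obtain x where x: "x \<in> ?S" and max: "\<And>y. y \<in> ?S \<Longrightarrow> inner (M *v y) y \<le> inner (M *v x) x"
    using continuous_attains_sup[OF _ ne, of "\<lambda>x. inner (M *v x) x"] by blast
  define m where "m = inner (M *v x) x"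
  define q where "q y = m * inner y y - inner (M *v y) y" for y
  have q_nonneg: "q y \<ge> 0" if "y \<in> V" for y
  proof (cases "y = 0")
    case False
    then have "y /\<^sub>R norm y \<in> ?S"
      using V(1) that by (simp add: subspace_scale)
    from max[OF this] False show ?thesis
      by (simp add: m_def[symmetric] q_def matrix_vector_mult_scaleR_gen dot_square_norm
          divide_simps power2_eq_square split: if_splits)
  qed (simp add: q_def)
  define h where "h = m *\<^sub>R x - M *v x"
  have hV: "h \<in> V"
    using x V by (simp add: h_def subspace_diff subspace_scale)
  have nx: "inner x x = 1"
    using x by (simp add: dot_square_norm)
  \<comment> \<open>q is nonnegative on V and vanishes at x, so x minimises q there. Perturbing x
    along its own defect h produces the linear term that forces h to vanish.\<close>
  have key: "0 \<le> - 2 * t * inner h h + t\<^sup>2 * q h" for t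
  proof -
    have "q (x - t *\<^sub>R h) = q x - 2 * t * (m * inner x h - inner (M *v x) h) + t\<^sup>2 * q h"
      using hermitian_inner[OF M, of h x]
      by (simp add: q_def matrix_vector_mult_diff_distrib matrix_vector_mult_scaleR_gen
          inner_diff_left inner_diff_right inner_commute power2_eq_square algebra_simps)
    moreover have "m * inner x h - inner (M *v x) h = inner h h"
      by (subst (3) h_def) (simp add: inner_diff_left)
    moreover have "q x = 0"
      using nx by (simp add: q_def m_def)
    moreover have "x - t *\<^sub>R h \<in> V"
      using x hV V(1) by (simp add: subspace_diff subspace_scale)
    ultimately show ?thesis
      using q_nonneg[of "x - t *\<^sub>R h"] by simp
  qed
  have "inner h h \<le> 0"
  proof (rule ccontr)
    assume a: "\<not> inner h h \<le> 0"
    have qh: "q h \<ge> 0" using hV q_nonneg by blast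
    \<comment> \<open>The added 1 keeps the denominator positive when q h = 0; for this t the linear
      term outweighs the quadratic one.\<close>
    define t where "t = inner h h / (q h + 1)"
    have hh: "inner h h > 0" using a by linarith
    have t: "t > 0" unfolding t_def using hh qh by (intro divide_pos_pos) linarith+
    have "t * q h < 2 * inner h h"
    proof -
      have "t * q h \<le> t * (q h + 1)" using t by (intro mult_left_mono) auto
      also have "\<dots> = inner h h" using qh by (simp add: t_def)
      finally show ?thesis using hh by linarith
    qed
    then have "t * (t * q h) < t * (2 * inner h h)"
      using t by simp
    then show False
      using key[of t] by (simp add: power2_eq_square algebra_simps)
  qed
  then have "h = 0"
    by (metis inner_eq_zero_iff inner_ge_zero order_antisym)
  then show ?thesis
    using x nx by (intro exI[of _ m] exI[of _ x]) (auto simp: h_def)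
qed

lemma sum_matrix_vector_mult: "(\<Sum>i\<in>I. F i) *v x = (\<Sum>i\<in>I. F i *v x)"
  by (induction I rule: infinite_finite_induct) (auto simp: matrix_vector_mult_add_rdistrib)

lemma eigproj:
  assumes M: "hermitian M"
  shows hermitian_eigproj: "hermitian (eigproj M r)"
    and eigproj_eigenvector: "M *v (eigproj M r *v x) = r *\<^sub>R (eigproj M r *v x)"
    and eigproj_eigproj: "eigproj M r *v (eigproj M s *v x) = (if r = s then eigproj M s *v x else 0)"
    and eigproj_of_eigenvector: "M *v y = s *\<^sub>R y \<Longrightarrow> eigproj M r *v y = (if r = s then y else 0)"
proof -
  note sub = subspace_mat_eigenspace[of M "complex_of_real r"]
  show "hermitian (eigproj M r)"
    unfolding eigproj_def using sub by (rule hermitian_orth_proj)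
  have ev: "M *v (eigproj M r *v x) = r *\<^sub>R (eigproj M r *v x)" for r x
    using orth_proj_in[OF subspace_mat_eigenspace] unfolding eigproj_def mem_mat_eigenspace_real[symmetric] .
  then show "M *v (eigproj M r *v x) = r *\<^sub>R (eigproj M r *v x)" .
  have *: "eigproj M r *v y = (if r = s then y else 0)" if "M *v y = s *\<^sub>R y" for s y
    using that orth_proj_id[OF sub, of y] orth_proj_zero[OF sub, of y]
      mat_eigenspaces_orthogonal[OF M, of s r y]
    by (auto simp: eigproj_def mem_mat_eigenspace_real)
  then show "M *v y = s *\<^sub>R y \<Longrightarrow> eigproj M r *v y = (if r = s then y else 0)" .
  show "eigproj M r *v (eigproj M s *v x) = (if r = s then eigproj M s *v x else 0)"
    using *[OF ev] .
qed

lemma eigproj_eq_zero: "r \<notin> eigvals M \<Longrightarrow> eigproj M r *v x = 0"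
  using orth_proj_in[OF subspace_mat_eigenspace, of M "complex_of_real r" x]
  by (auto simp: eigproj_def eigvals_def)

text \<open>Completeness: the vectors orthogonal to all eigenvectors form an invariant subspace, and
  a nonzero one would contain an eigenvector orthogonal to itself. The difference of the two sides
  lies in this subspace.\<close>

lemma sum_eigproj:
  assumes M: "hermitian M"
  shows "(\<Sum>r\<in>eigvals M. eigproj M r *v x) = x"
proof -
  define E where "E = {z. \<exists>r. M *v z = r *\<^sub>R z}"
  define V where "V = {y. \<forall>z\<in>E. inner y z = 0}"
  have V: "subspace V"
    unfolding subspace_def V_def by (simp add: inner_add_left)
  have inv: "M *v y \<in> V" if "y \<in> V" for y
    using that by (auto simp: V_def E_def hermitian_inner[OF M])
  have V0: "y = 0" if "y \<in> V" for y
  proof (rule ccontr)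
    assume "y \<noteq> 0"
    then obtain r z where "z \<in> V" "z \<noteq> 0" "M *v z = r *\<^sub>R z"
      using hermitian_invariant_subspace_eigenvector[OF M V inv] \<open>y \<in> V\<close> by blast
    then have "inner z z = 0"
      unfolding V_def E_def by blast
    then show False using \<open>z \<noteq> 0\<close> by simp
  qed
  have "inner (x - (\<Sum>r\<in>eigvals M. eigproj M r *v x)) z = 0" if z: "M *v z = s *\<^sub>R z" for s z
  proof -
    have s: "z = 0" if "s \<notin> eigvals M"
      using that z unfolding eigvals_def mem_mat_eigenspace_real[symmetric] by auto
    have "inner (\<Sum>r\<in>eigvals M. eigproj M r *v x) z
        = (\<Sum>r\<in>eigvals M. inner x (eigproj M r *v z))"
      by (simp add: inner_sum_left hermitian_inner[OF hermitian_eigproj[OF M]])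
    also have "\<dots> = (\<Sum>r\<in>eigvals M. if r = s then inner x z else 0)"
      by (intro sum.cong) (auto simp: eigproj_of_eigenvector[OF M z])
    also have "\<dots> = inner x z"
      using s by (cases "s \<in> eigvals M") (simp_all add: finite_eigvals[OF M])
    finally show ?thesis
      by (simp add: inner_diff_left)
  qed
  then have "x - (\<Sum>r\<in>eigvals M. eigproj M r *v x) \<in> V"
    by (auto simp: V_def E_def)
  from V0[OF this] show ?thesis by simp
qed

text \<open>The functional calculus of a Hermitian matrix. Square root, spectral projection,
  positive part and positive inverse all become instances, and identities between them reduce to
  scalar identities on eigenvalues.\<close>

definition mat_fun :: "complex^'d^'d \<Rightarrow> (real \<Rightarrow> real) \<Rightarrow> complex^'d^'d" where
  "mat_fun M f = (\<Sum>r\<in>eigvals M. mat (complex_of_real (f r)) ** eigproj M r)"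

lemma mat_mult_vec: "mat c *v x = c *s x"
  by (simp add: vec_eq_iff matrix_vector_mult_def mat_def if_distrib[of "\<lambda>a. a * _"] cong: if_cong)

lemma mat_complex_of_real_mult_vec: "mat (complex_of_real c) *v x = c *\<^sub>R x"
  by (simp add: mat_mult_vec complex_of_real_scale_vec)

lemma mat_fun_mult_vec: "mat_fun M f *v x = (\<Sum>r\<in>eigvals M. f r *\<^sub>R (eigproj M r *v x))"
  by (simp add: mat_fun_def sum_matrix_vector_mult matrix_vector_mul_assoc[symmetric]
      mat_complex_of_real_mult_vec)

lemma hermitian_mat_fun: "hermitian M \<Longrightarrow> hermitian (mat_fun M f)"
  by (simp add: hermitian_iff_inner[of "mat_fun M f"] mat_fun_mult_vec inner_sum_left inner_sum_right
      hermitian_inner[OF hermitian_eigproj])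

lemma eigproj_mat_fun:
  assumes M: "hermitian M"
  shows "eigproj M s *v (mat_fun M f *v x) = f s *\<^sub>R (eigproj M s *v x)"
proof -
  have "eigproj M s *v (mat_fun M f *v x)
      = (\<Sum>r\<in>eigvals M. f r *\<^sub>R (eigproj M s *v (eigproj M r *v x)))"
    by (simp add: mat_fun_mult_vec vec.sum matrix_vector_mult_scaleR_gen)
  also have "\<dots> = (\<Sum>r\<in>eigvals M. if r = s then f s *\<^sub>R (eigproj M s *v x) else 0)"
    by (intro sum.cong) (auto simp: eigproj_eigproj[OF M])
  also have "\<dots> = f s *\<^sub>R (eigproj M s *v x)"
    using eigproj_eq_zero[of s M x] by (simp add: finite_eigvals[OF M])
  finally show ?thesis .
qed

lemma mat_fun_mat_fun:
  "hermitian M \<Longrightarrow> mat_fun M f *v (mat_fun M g *v x) = mat_fun M (\<lambda>r. f r * g r) *v x"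
  by (simp add: mat_fun_mult_vec[of M f] mat_fun_mult_vec[of M "\<lambda>r. f r * g r"] eigproj_mat_fun)

lemma mat_fun_mult:
  "hermitian M \<Longrightarrow> mat_fun M f ** mat_fun M g = mat_fun M (\<lambda>r. f r * g r)"
  by (simp add: matrix_eq matrix_vector_mul_assoc[symmetric] mat_fun_mat_fun)

lemma mat_fun_one: "hermitian M \<Longrightarrow> mat_fun M (\<lambda>r. 1) *v x = x"
  by (simp add: mat_fun_mult_vec sum_eigproj)

lemma mat_fun_id: "hermitian M \<Longrightarrow> mat_fun M (\<lambda>r. r) = M"
  by (simp add: matrix_eq mat_fun_mult_vec eigproj_eigenvector[symmetric] vec.sum[symmetric] sum_eigproj)

lemma mat_fun_cong: "(\<And>r. r \<in> eigvals M \<Longrightarrow> f r = g r) \<Longrightarrow> mat_fun M f = mat_fun M g"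
  by (simp add: mat_fun_def)

lemma inner_mat_fun:
  assumes M: "hermitian M"
  shows "inner (mat_fun M f *v x) x = (\<Sum>r\<in>eigvals M. f r * (norm (eigproj M r *v x))\<^sup>2)"
proof -
  have "inner (eigproj M r *v x) x = (norm (eigproj M r *v x))\<^sup>2" for r
    using hermitian_inner[OF hermitian_eigproj[OF M], of r "eigproj M r *v x" x]
    by (simp add: eigproj_eigproj[OF M] dot_square_norm inner_commute)
  then show ?thesis
    by (simp add: mat_fun_mult_vec inner_sum_left)
qed

lemma pos_semidef_mat_fun:
  "hermitian M \<Longrightarrow> (\<And>r. r \<in> eigvals M \<Longrightarrow> 0 \<le> f r) \<Longrightarrow> pos_semidef (mat_fun M f)"
  by (simp add: pos_semidef_iff_inner hermitian_mat_fun inner_mat_fun sum_nonneg)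

lemma eigvals_nonneg:
  assumes "pos_semidef M" "r \<in> eigvals M"
  shows "0 \<le> r"
proof -
  obtain x where x: "x \<noteq> 0" "M *v x = r *\<^sub>R x"
    using assms(2) vec.subspace_0[OF subspace_mat_eigenspace, of M]
    unfolding eigvals_def mem_mat_eigenspace_real[symmetric] by blast
  then have "0 \<le> r * inner x x"
    using assms(1) unfolding pos_semidef_iff_inner by (metis inner_scaleR_left)
  moreover have "0 < inner x x" using x by simp
  ultimately show ?thesis
    by (metis zero_le_mult_iff not_le)
qed


subsection \<open>Square roots and the positive inverse\<close>

text \<open>Every eigenvector of \<open>S\<close> is an eigenvector of any other square root \<open>T\<close>, since
  \<open>(T + s) (T - s)\<close> annihilates it.\<close>

lemma pos_semidef_sqrt_unique:
  assumes S: "pos_semidef S" and T: "pos_semidef T" and eq: "S ** S = T ** T"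
  shows "S = T"
proof -
  have hS: "hermitian S" using S by (simp add: pos_semidef_def)
  have ev: "T *v y = s *\<^sub>R y" if y: "S *v y = s *\<^sub>R y" and s: "0 \<le> s" for y s
  proof -
    define z where "z = T *v y - s *\<^sub>R y"
    have "T *v (T *v y) = S *v (S *v y)"
      by (simp add: matrix_vector_mul_assoc eq)
    then have TT: "T *v (T *v y) = (s * s) *\<^sub>R y"
      by (simp add: y matrix_vector_mult_scaleR_gen)
    show ?thesis
    \<comment> \<open>For s = 0 the factor T + s is not strictly positive, so positivity gives
      nothing; instead T (T y) = 0 yields |T y| = 0 directly.\<close>
    proof (cases "s = 0")
      case True
      have "inner (T *v y) (T *v y) = inner (T *v (T *v y)) y"
        using T by (metis hermitian_inner pos_semidef_def)
      then show ?thesis using TT True by simp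
    next
      case False
      have "T *v z = - s *\<^sub>R z"
        by (simp add: z_def matrix_vector_mult_diff_distrib matrix_vector_mult_scaleR_gen TT algebra_simps)
      moreover have "0 \<le> inner (T *v z) z"
        using T by (simp add: pos_semidef_iff_inner)
      ultimately have "s * inner z z \<le> 0" by simp
      then have "inner z z \<le> 0"
        using s False by (simp add: mult_le_0_iff)
      then have "z = 0" by (metis inner_eq_zero_iff inner_ge_zero order_antisym)
      then show ?thesis by (simp add: z_def)
    qed
  qed
  have "T *v x = S *v x" for x
  proof -
    have "T *v (\<Sum>r\<in>eigvals S. eigproj S r *v x) = (\<Sum>r\<in>eigvals S. r *\<^sub>R (eigproj S r *v x))"
      unfolding vec.sum
      by (intro sum.cong refl ev eigproj_eigenvector hS eigvals_nonneg[OF S])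
    also have "\<dots> = S *v (\<Sum>r\<in>eigvals S. eigproj S r *v x)"
      by (simp add: vec.sum eigproj_eigenvector[OF hS])
    finally show ?thesis by (simp only: sum_eigproj[OF hS])
  qed
  then show ?thesis by (simp add: matrix_eq)
qed

text \<open>\<open>mat_fun M sqrt\<close> provides existence; together with uniqueness the definite
  description is proper.\<close>

lemma psd_sqrt:
  assumes M: "pos_semidef M"
  shows pos_semidef_psd_sqrt: "pos_semidef (psd_sqrt M)"
    and psd_sqrt_mult_self: "psd_sqrt M ** psd_sqrt M = M"
proof -
  have h: "hermitian M" using M by (simp add: pos_semidef_def)
  have "mat_fun M sqrt ** mat_fun M sqrt = mat_fun M (\<lambda>r. r)"
    unfolding mat_fun_mult[OF h] by (rule mat_fun_cong) (simp add: eigvals_nonneg[OF M])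
  then have "pos_semidef (mat_fun M sqrt) \<and> mat_fun M sqrt ** mat_fun M sqrt = M"
    using mat_fun_id[OF h] eigvals_nonneg[OF M] by (simp add: pos_semidef_mat_fun[OF h])
  then have "\<exists>!S. pos_semidef S \<and> S ** S = M"
    using pos_semidef_sqrt_unique by metis
  from theI'[OF this] show "pos_semidef (psd_sqrt M)" "psd_sqrt M ** psd_sqrt M = M"
    by (auto simp: psd_sqrt_def)
qed

lemma spectral_proj_eq:
  "hermitian M \<Longrightarrow> spectral_proj M S = mat_fun M (\<lambda>r. if r \<in> S then 1 else 0)"
  unfolding matrix_eq
proof
  fix x assume M: "hermitian M"
  have "spectral_proj M S *v x = (\<Sum>r\<in>{r \<in> eigvals M. r \<in> S}. eigproj M r *v x)"
    unfolding spectral_proj_def sum_matrix_vector_mult eigproj_def[symmetric]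
    by (intro sum.cong) (auto simp: eigvals_def)
  also have "\<dots> = mat_fun M (\<lambda>r. if r \<in> S then 1 else 0) *v x"
    by (simp add: mat_fun_mult_vec finite_eigvals[OF M] sum.inter_filter if_distrib[of "\<lambda>a. a *\<^sub>R _"] cong: if_cong)
  finally show "spectral_proj M S *v x = mat_fun M (\<lambda>r. if r \<in> S then 1 else 0) *v x" .
qed

lemma pos_part_eq: "hermitian M \<Longrightarrow> pos_part M = mat_fun M (\<lambda>r. if 0 < r then r else 0)"
proof -
  assume M: "hermitian M"
  have "pos_part M = mat_fun M (\<lambda>r. r) ** mat_fun M (\<lambda>r. if r \<in> {0<..} then 1 else 0)"
    by (simp add: pos_part_def spectral_proj_eq[OF M] mat_fun_id[OF M])
  then show ?thesis
    by (simp add: mat_fun_mult[OF M] if_distrib[of "\<lambda>a. _ * a"] cong: if_cong)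
qed

lemma cinner_eq_0_iff: "cinner x y = 0 \<longleftrightarrow> inner x y = 0 \<and> inner x (\<i> *s y) = 0"
  by (simp add: complex_eq_iff Re_cinner Im_cinner)

text \<open>The two defining conditions fix G on the range of the positive part Q and on its
  orthogonal complement. P projects onto that range, so these two pieces determine G.\<close>

lemma pos_inv_eq:
  fixes M :: "complex^'d^'d"
  assumes M: "hermitian M"
  shows "pos_inv M = mat_fun M (\<lambda>r. if 0 < r then 1 / r else 0)" (is "_ = ?G")
proof -
  define P where "P = mat_fun M (\<lambda>r. if 0 < r then 1 else 0)"
  define Q where "Q = pos_part M"
  note Q = Q_def[unfolded pos_part_eq[OF M]]
  have QG: "Q *v (?G *v x) = P *v x" and GQ: "?G *v (Q *v x) = P *v x"
    and PQ: "P *v (Q *v x) = Q *v x" and QP: "Q *v (P *v x) = Q *v x" and GP: "?G *v (P *v x) = ?G *v x" for x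
    unfolding Q P_def mat_fun_mat_fun[OF M]
    by (rule arg_cong[of _ _ "\<lambda>A. A *v x"], rule mat_fun_cong, simp)+
  have hQ: "hermitian Q" unfolding Q by (rule hermitian_mat_fun[OF M])
  have Prange: "P *v y = y" if "y \<in> range ((*v) Q)" for y
    using that PQ by auto
  let ?prop = "\<lambda>G. (\<forall>y \<in> range ((*v) Q). G *v y \<in> range ((*v) Q) \<and> Q *v (G *v y) = y) \<and>
     (\<forall>x. (\<forall>y \<in> range ((*v) Q). cinner x y = 0) \<longrightarrow> G *v x = 0)"
  have 1: "?prop ?G"
  proof (intro conjI ballI allI impI)
    fix y assume y: "y \<in> range ((*v) Q)"
    then obtain w where w: "y = Q *v w" by blast
    have "P *v w = Q *v (?G *v w)" by (simp add: QG)
    then show "?G *v y \<in> range ((*v) Q)" by (simp add: w GQ)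
    show "Q *v (?G *v y) = y" using y by (simp add: QG Prange)
  next
    fix x assume "\<forall>y \<in> range ((*v) Q). cinner x y = 0"
    \<comment> \<open>Testing orthogonality with Q (Q x) gives |Q x|^2 = 0.\<close>
    then have "inner x (Q *v (Q *v x)) = 0"
      unfolding cinner_eq_0_iff by blast
    then have "Q *v x = 0"
      by (metis hQ hermitian_inner inner_eq_zero_iff)
    then have "P *v x = 0" by (metis GQ matrix_vector_mult_0_right)
    then show "?G *v x = 0" by (metis GP matrix_vector_mult_0_right)
  qed
  have 2: "G = ?G" if G: "?prop G" for G
  proof -
    have "G *v x = ?G *v x" for x
    proof -
      have "P *v x = Q *v (?G *v x)" by (simp add: QG)
      then have Px: "P *v x \<in> range ((*v) Q)" by simp
      have "inner (x - P *v x) (Q *v y) = 0" for y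
        using hermitian_inner[OF hQ, of "x - P *v x" y]
        by (simp add: matrix_vector_mult_diff_distrib QP)
      then have "cinner (x - P *v x) y = 0" if "y \<in> range ((*v) Q)" for y
        using that unfolding cinner_eq_0_iff by (auto simp: vector_scalar_commute[symmetric])
      then have "G *v (x - P *v x) = 0" using G by blast
      then have "G *v x = G *v (P *v x)" by (simp add: matrix_vector_mult_diff_distrib)
      \<comment> \<open>G maps the range of Q into itself, where \<open>?G\<close> inverts Q;
        applying \<open>?G\<close> to Q (G (P x)) = P x therefore identifies G (P x).\<close>
      also have "G *v (P *v x) = P *v (G *v (P *v x))"
        using G Px Prange by metis
      also have "\<dots> = ?G *v (Q *v (G *v (P *v x)))" by (simp add: GQ)
      also have "Q *v (G *v (P *v x)) = P *v x" using G Px by blast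
      finally show ?thesis by (simp add: GP)
    qed
    then show ?thesis by (simp add: matrix_eq)
  qed
  have "pos_inv M = (THE G. ?prop G)" by (simp add: pos_inv_def Q_def)
  also have "\<dots> = ?G" using 1 2 by (rule the_equality)
  finally show ?thesis .
qed


text \<open>For \<open>P\<close> the projection onto the positive part of \<open>M\<close>, the matrix \<open>S\<close> plays the role of
  \<open>(M\<^sup>-\<^sup>1\<^sup>/\<^sup>2)\<^sub>\<oplus>\<close>. With \<open>P = 1\<close> this covers \<open>M\<^sup>-\<^sup>1\<^sup>/\<^sup>2\<close> for positive definite \<open>M\<close>.\<close>

definition positive_root :: "complex^'d^'d \<Rightarrow> complex^'d^'d \<Rightarrow> complex^'d^'d \<Rightarrow> bool" where
  "positive_root M P S \<longleftrightarrow> hermitian M \<and> hermitian P \<and> hermitian S \<and>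
     (\<forall>x. P *v (P *v x) = P *v x) \<and> (\<forall>x. M *v (P *v x) = P *v (M *v x)) \<and>
     (\<forall>x. S *v (S *v (M *v (P *v x))) = P *v x) \<and>
     (\<forall>x. inner (M *v (x - P *v x)) (x - P *v x) \<le> 0)"

lemma positive_root_pos_inv_sqrt:
  assumes M: "hermitian M"
  shows "positive_root M (spectral_proj M {0<..}) (pos_inv_sqrt M)"
    and "pos_inv_sqrt M ** pos_inv_sqrt M = pos_inv M"
proof -
  define P where "P = mat_fun M (\<lambda>r. if 0 < r then 1 else 0)"
  have P: "spectral_proj M {0<..} = P"
    by (simp add: spectral_proj_eq[OF M] P_def)
  have G: "pos_semidef (pos_inv M)"
    unfolding pos_inv_eq[OF M] by (rule pos_semidef_mat_fun[OF M]) auto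
  show SS: "pos_inv_sqrt M ** pos_inv_sqrt M = pos_inv M"
    unfolding pos_inv_sqrt_def by (rule psd_sqrt_mult_self[OF G])
  have "hermitian (pos_inv_sqrt M)"
    using pos_semidef_psd_sqrt[OF G] by (simp add: pos_inv_sqrt_def pos_semidef_def)
  moreover have "hermitian P"
    unfolding P_def by (rule hermitian_mat_fun[OF M])
  moreover have "P *v (P *v x) = P *v x" for x
    unfolding P_def mat_fun_mat_fun[OF M]
    by (rule arg_cong[of _ _ "\<lambda>A. A *v x"], rule mat_fun_cong) simp
  moreover have "M *v (P *v x) = P *v (M *v x)" for x
  proof -
    have "mat_fun M (\<lambda>r. r) *v (P *v x) = P *v (mat_fun M (\<lambda>r. r) *v x)"
      unfolding P_def mat_fun_mat_fun[OF M]
      by (rule arg_cong[of _ _ "\<lambda>A. A *v x"], rule mat_fun_cong) simp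
    then show ?thesis by (simp add: mat_fun_id[OF M])
  qed
  moreover have "pos_inv_sqrt M *v (pos_inv_sqrt M *v (M *v (P *v x))) = P *v x" for x
  proof -
    have "pos_inv M *v (mat_fun M (\<lambda>r. r) *v (P *v x)) = P *v x"
      unfolding P_def pos_inv_eq[OF M] mat_fun_mat_fun[OF M]
      by (rule arg_cong[of _ _ "\<lambda>A. A *v x"], rule mat_fun_cong) simp
    then show ?thesis
      by (simp add: mat_fun_id[OF M] SS[symmetric] matrix_vector_mul_assoc[symmetric])
  qed
  moreover have "inner (M *v (x - P *v x)) (x - P *v x) \<le> 0" for x
  proof -
    \<comment> \<open>The complementary projection 1 - P; compressing M by it leaves only the
      nonpositive eigenvalues.\<close>
    define Q where "Q = mat_fun M (\<lambda>r. if 0 < r then 0 else 1)"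
    have "mat_fun M (\<lambda>r. if 0 < r then 1 else 0) *v x + Q *v x = mat_fun M (\<lambda>r. 1) *v x"
      unfolding Q_def mat_fun_mult_vec sum.distrib[symmetric] by (intro sum.cong) auto
    then have xP: "x - P *v x = Q *v x"
      by (simp add: P_def mat_fun_one[OF M] algebra_simps)
    have "hermitian Q" unfolding Q_def by (rule hermitian_mat_fun[OF M])
    then have "inner (M *v (Q *v x)) (Q *v x) = inner (Q *v (M *v (Q *v x))) x"
      by (simp add: hermitian_inner)
    also have "Q *v (M *v (Q *v x)) = Q *v (mat_fun M (\<lambda>r. r) *v (Q *v x))"
      by (simp add: mat_fun_id[OF M])
    also have "\<dots> = mat_fun M (\<lambda>r. if 0 < r then 0 else r) *v x"
      unfolding Q_def mat_fun_mat_fun[OF M]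
      by (rule arg_cong[of _ _ "\<lambda>A. A *v x"], rule mat_fun_cong) simp
    also have "inner (mat_fun M (\<lambda>r. if 0 < r then 0 else r) *v x) x \<le> 0"
      unfolding inner_mat_fun[OF M] by (rule sum_nonpos) (simp add: mult_nonpos_nonneg)
    finally show ?thesis by (simp add: xP)
  qed
  ultimately show "positive_root M (spectral_proj M {0<..}) (pos_inv_sqrt M)"
    unfolding positive_root_def P using M by blast
qed

lemma inner_ge_of_pos_semidef_diff:
  "pos_semidef (M - mat (complex_of_real c)) \<Longrightarrow> c * (norm x)\<^sup>2 \<le> inner (M *v x) x"
  by (drule pos_semidef_iff_inner[THEN iffD1, THEN conjunct2, rule_format, of _ x])
    (simp add: matrix_vector_mult_diff_rdistrib mat_complex_of_real_mult_vec inner_diff_left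
      dot_square_norm)

text \<open>The bound by c > 0 makes M injective, hence invertible. Evaluating the form of M at
  \<open>matrix_inv M *v x\<close> shows that the inverse is positive semidefinite, so its square
  root behaves as specified.\<close>

lemma positive_root_inv_sqrt:
  assumes M: "hermitian M" and pos: "pos_semidef (M - mat (complex_of_real c))" "0 < c"
  shows "positive_root M (mat 1) (inv_sqrt M)"
proof -
  have lower: "c * (norm x)\<^sup>2 \<le> inner (M *v x) x" for x
    using pos(1) by (rule inner_ge_of_pos_semidef_diff)
  have "x = 0" if "M *v x = 0" for x
    using lower[of x] that pos(2) by (simp add: mult_le_0_iff)
  then have "\<exists>N. M ** N = mat 1 \<and> N ** M = mat 1"
    using matrix_left_invertible_ker[of M] matrix_left_right_inverse by blast
  then have inv: "M ** matrix_inv M = mat 1" "matrix_inv M ** M = mat 1"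
    unfolding matrix_inv_def by (metis (mono_tags, lifting) someI)+
  have M_inv: "M *v (matrix_inv M *v x) = x" and inv_M: "matrix_inv M *v (M *v x) = x" for x
    by (simp_all add: matrix_vector_mul_assoc inv)
  have "inner (matrix_inv M *v x) y = inner x (matrix_inv M *v y)" for x y
    using hermitian_inner[OF M, of "matrix_inv M *v x" "matrix_inv M *v y"] by (simp add: M_inv)
  moreover have "0 \<le> inner (matrix_inv M *v x) x" for x
  proof -
    have "0 \<le> c * (norm (matrix_inv M *v x))\<^sup>2" using pos(2) by simp
    also have "\<dots> \<le> inner (M *v (matrix_inv M *v x)) (matrix_inv M *v x)" by (rule lower)
    finally show ?thesis by (simp add: M_inv inner_commute)
  qed
  ultimately have G: "pos_semidef (matrix_inv M)"
    unfolding pos_semidef_iff_inner hermitian_iff_inner by blast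
  have "hermitian (inv_sqrt M)"
    using pos_semidef_psd_sqrt[OF G] by (simp add: inv_sqrt_def pos_semidef_def)
  moreover have "inv_sqrt M *v (inv_sqrt M *v (M *v x)) = x" for x
    by (metis G inv_M inv_sqrt_def matrix_vector_mul_assoc psd_sqrt_mult_self)
  moreover have "hermitian (mat 1 :: complex^'d^'d)"
    by (simp add: hermitian_iff_inner)
  ultimately show ?thesis
    unfolding positive_root_def using M by simp
qed

text \<open>y x plays the role of M^(1/2) P x, expressed without a root of M: it recovers P x
  through S, and its norm squared is the positive diagonal form.\<close>

lemma positive_root_norm:
  assumes "positive_root M P S"
  defines "y \<equiv> \<lambda>x. S *v (M *v (P *v x))"
  shows "S *v y x = P *v x" and "(norm (y x))\<^sup>2 = inner (M *v (P *v x)) (P *v x)"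
proof -
  show 1: "S *v y x = P *v x"
    using assms(1) unfolding y_def positive_root_def by blast
  have "hermitian S" using assms(1) by (simp add: positive_root_def)
  then have "(norm (y x))\<^sup>2 = inner (M *v (P *v x)) (S *v y x)"
    by (metis dot_square_norm hermitian_inner y_def)
  then show "(norm (y x))\<^sup>2 = inner (M *v (P *v x)) (P *v x)"
    by (simp add: 1)
qed

section \<open>Operator norm bounds for couplings and diagonal forms\<close>

lemma norm_matrix_vector_le: "norm (M *v x) \<le> matrix_norm M * norm x"
  unfolding matrix_norm_def by (rule onorm) simp

lemma matrix_norm_nonneg: "0 \<le> matrix_norm M"
  unfolding matrix_norm_def by (rule onorm_pos_le) simp

text \<open>Substituting P x = S y and P' x' = S' y' turns the coupling into the form of S C S',
  which the hypothesis bounds. The norms of y and y' are the diagonal forms, and 2 |y| |y'| is at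
  most |y|^2 + |y'|^2.\<close>

lemma positive_root_coupling:
  assumes r: "positive_root M P S" "positive_root M' P' S'"
    and le: "matrix_norm (S ** C ** S') \<le> a"
  shows "2 * \<bar>inner (C *v (P' *v x')) (P *v x)\<bar>
      \<le> a * (inner (M *v (P *v x)) (P *v x) + inner (M' *v (P' *v x')) (P' *v x'))"
proof -
  define y y' where "y = S *v (M *v (P *v x))" and "y' = S' *v (M' *v (P' *v x'))"
  note y = positive_root_norm[OF r(1), of x, folded y_def]
  note y' = positive_root_norm[OF r(2), of x', folded y'_def]
  have "inner (C *v (P' *v x')) (P *v x) = inner ((S ** C ** S') *v y') y"
    using r(1) by (simp add: y(1)[symmetric] y'(1)[symmetric] positive_root_def hermitian_inner
        matrix_vector_mul_assoc[symmetric])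
  also have "\<bar>\<dots>\<bar> \<le> norm ((S ** C ** S') *v y') * norm y"
    by (rule Cauchy_Schwarz_ineq2)
  also have "\<dots> \<le> (a * norm y') * norm y"
    by (intro mult_right_mono order_trans[OF norm_matrix_vector_le] le) auto
  finally have "2 * \<bar>inner (C *v (P' *v x')) (P *v x)\<bar> \<le> a * (2 * norm y' * norm y)"
    by (simp add: mult_ac)
  also have "\<dots> \<le> a * ((norm y')\<^sup>2 + (norm y)\<^sup>2)"
    using matrix_norm_nonneg[of "S ** C ** S'"] le
    by (intro mult_left_mono sum_squares_bound) auto
  finally show ?thesis
    by (simp add: y y' add_ac)
qed

text \<open>Smallness of S S, the positive inverse, becomes largeness of M on the range of P. This
  is how the condition on the even diagonal blocks enters.\<close>

lemma positive_root_norm_le: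
  assumes r: "positive_root M P S" and le: "matrix_norm (S ** S) \<le> e"
  shows "(norm (P *v x))\<^sup>2 \<le> e * inner (M *v (P *v x)) (P *v x)"
proof -
  define y where "y = S *v (M *v (P *v x))"
  note y = positive_root_norm[OF r, of x, folded y_def]
  have "(norm (P *v x))\<^sup>2 = inner ((S ** S) *v y) y"
    using r by (simp add: y(1)[symmetric] positive_root_def hermitian_inner dot_square_norm[symmetric]
        matrix_vector_mul_assoc[symmetric])
  also have "\<dots> \<le> norm ((S ** S) *v y) * norm y"
    by (rule norm_cauchy_schwarz)
  also have "\<dots> \<le> (e * norm y) * norm y"
    by (intro mult_right_mono order_trans[OF norm_matrix_vector_le] le) auto
  also have "\<dots> = e * (norm y)\<^sup>2" by (simp add: power2_eq_square)
  finally show ?thesis by (simp add: y)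
qed

text \<open>The operator norm is dominated by the sum of the row norms, which is continuous in the
  entries.\<close>

lemma tendsto_matrix_norm:
  assumes "(F \<longlongrightarrow> (0 :: complex^'n^'m)) X"
  shows "((\<lambda>k. matrix_norm (F k)) \<longlongrightarrow> 0) X"
proof (rule Lim_null_comparison)
  show "((\<lambda>k. \<Sum>i\<in>UNIV. norm (F k $ i)) \<longlongrightarrow> 0) X"
    using tendsto_sum[of UNIV "\<lambda>i k. norm (F k $ i)" "\<lambda>i. 0" X]
      tendsto_norm_zero[OF tendsto_vec_nth[OF assms, simplified]] by simp
  have "matrix_norm M \<le> (\<Sum>i\<in>UNIV. norm (M $ i))" for M :: "complex^'n^'m"
    unfolding matrix_norm_def
  proof (rule onorm_le)
    fix x
    have "norm ((M *v x) $ i) \<le> norm (M $ i) * norm x" for i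
    proof -
      have "norm ((M *v x) $ i) \<le> (\<Sum>j\<in>UNIV. \<bar>norm (M $ i $ j)\<bar> * \<bar>norm (x $ j)\<bar>)"
        unfolding matrix_vector_mult_def by (simp add: norm_mult[symmetric] norm_sum)
      also have "\<dots> \<le> norm (M $ i) * norm x"
        unfolding norm_vec_def by (rule L2_set_mult_ineq)
      finally show ?thesis .
    qed
    then have "(\<Sum>i\<in>UNIV. norm ((M *v x) $ i)) \<le> (\<Sum>i\<in>UNIV. norm (M $ i)) * norm x"
      by (simp add: sum_mono sum_distrib_right)
    then show "norm (M *v x) \<le> (\<Sum>i\<in>UNIV. norm (M $ i)) * norm x"
      using L2_set_le_sum[of UNIV "\<lambda>i. norm ((M *v x) $ i)"] by (simp add: norm_vec_def[of "M *v x"])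
  qed
  then show "\<forall>\<^sub>F k in X. norm (matrix_norm (F k)) \<le> (\<Sum>i\<in>UNIV. norm (F k $ i))"
    by (simp add: matrix_norm_nonneg)
qed


subsection \<open>Orthogonal projection in a real Hilbert space\<close>

lemma Cauchy_if_norm_diff_le_null:
  fixes x :: "nat \<Rightarrow> 'a::real_normed_vector"
  assumes le: "\<And>m n. norm (x m - x n) \<le> a m + a n" and null: "a \<longlonglongrightarrow> 0"
  shows "Cauchy x"
proof (rule CauchyI)
  fix e :: real assume "0 < e"
  then obtain N where N: "\<And>n. n \<ge> N \<Longrightarrow> \<bar>a n\<bar> < e / 2"
    using LIMSEQ_D[OF null, of "e / 2"] by auto
  have "norm (x m - x n) < e" if "m \<ge> N" "n \<ge> N" for m n
    using le[of m n] N[OF that(1)] N[OF that(2)] by linarith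
  then show "\<exists>N. \<forall>m\<ge>N. \<forall>n\<ge>N. norm (x m - x n) < e" by blast
qed

lemma subspace_closure:
  fixes S :: "'a::real_normed_vector set"
  assumes S: "subspace S"
  shows "subspace (closure S)"
proof (rule subspaceI)
  show "0 \<in> closure S"
    using subspace_0[OF S] closure_subset by blast
  show "x + y \<in> closure S" if xy: "x \<in> closure S" "y \<in> closure S" for x y
  proof -
    obtain u v where "\<And>n. u n \<in> S" "u \<longlonglongrightarrow> x" "\<And>n. v n \<in> S" "v \<longlonglongrightarrow> y"
      using xy unfolding closure_sequential by blast
    then have "\<forall>n. u n + v n \<in> S" "(\<lambda>n. u n + v n) \<longlonglongrightarrow> x + y"
      by (auto intro: subspace_add[OF S] tendsto_add)
    then show ?thesis
      unfolding closure_sequential by (intro exI[of _ "\<lambda>n. u n + v n"]) simp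
  qed
  show "c *\<^sub>R x \<in> closure S" if x: "x \<in> closure S" for c x
  proof -
    obtain u where "\<And>n. u n \<in> S" "u \<longlonglongrightarrow> x"
      using x unfolding closure_sequential by blast
    then have "\<forall>n. c *\<^sub>R u n \<in> S" "(\<lambda>n. c *\<^sub>R u n) \<longlonglongrightarrow> c *\<^sub>R x"
      by (auto intro: subspace_scale[OF S] tendsto_scaleR)
    then show ?thesis
      unfolding closure_sequential by (intro exI[of _ "\<lambda>n. c *\<^sub>R u n"]) simp
  qed
qed

text \<open>The parallelogram law makes a minimising sequence Cauchy, because midpoints stay in S;
  at the minimiser the first variation vanishes.\<close>

lemma orthogonal_projection_exists:
  fixes S :: "'a::{real_inner,complete_space} set"
  assumes S: "subspace S" "closed S"
  shows "\<exists>y\<in>S. \<forall>z\<in>S. inner (x - y) z = 0"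
proof -
  define D where "D = (INF y\<in>S. (norm (x - y))\<^sup>2)"
  have bdd: "bdd_below ((\<lambda>y. (norm (x - y))\<^sup>2) ` S)"
    by (rule bdd_belowI2[of _ 0]) simp
  have D_le: "D \<le> (norm (x - y))\<^sup>2" if "y \<in> S" for y
    unfolding D_def using bdd that by (rule cINF_lower)
  have "\<exists>y\<in>S. (norm (x - y))\<^sup>2 < D + 1 / real (Suc n)" for n
    using cINF_less_iff[OF _ bdd, of "D + 1 / real (Suc n)"] subspace_0[OF S(1)]
    unfolding D_def[symmetric] by auto
  then obtain y where y: "\<And>n. y n \<in> S" "\<And>n. (norm (x - y n))\<^sup>2 < D + 1 / real (Suc n)"
    by metis
  have par: "(norm (y m - y n))\<^sup>2 \<le> 2 / real (Suc m) + 2 / real (Suc n)" for m n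
  proof -
    have "(1/2) *\<^sub>R (y m + y n) \<in> S"
      using S(1) y(1) by (simp add: subspace_add subspace_scale)
    from D_le[OF this] have "4 * D \<le> (norm (2 *\<^sub>R (x - (1/2) *\<^sub>R (y m + y n))))\<^sup>2"
      unfolding norm_scaleR power_mult_distrib by simp
    also have "2 *\<^sub>R (x - (1/2) *\<^sub>R (y m + y n)) = (x - y m) + (x - y n)"
      by (simp add: algebra_simps scaleR_2)
    also have "(norm \<dots>)\<^sup>2 = 2 * (norm (x - y m))\<^sup>2 + 2 * (norm (x - y n))\<^sup>2 - (norm (y m - y n))\<^sup>2"
      by (simp add: power2_norm_eq_inner inner_add_left inner_add_right inner_diff_left
          inner_diff_right inner_commute)
    finally show ?thesis
      using y(2)[of m] y(2)[of n] by (simp add: add_divide_distrib[symmetric])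
  qed
  have "Cauchy y"
  proof (rule Cauchy_if_norm_diff_le_null)
    fix m n
    have "norm (y m - y n) \<le> sqrt (2 / real (Suc m) + 2 / real (Suc n))"
      by (rule real_le_rsqrt) (rule par)
    also have "\<dots> \<le> sqrt (2 / real (Suc m)) + sqrt (2 / real (Suc n))"
      by (rule sqrt_add_le_add_sqrt) auto
    finally show "norm (y m - y n) \<le> sqrt (2 / real (Suc m)) + sqrt (2 / real (Suc n))" .
  next
    have "(\<lambda>n. 2 * inverse (real (Suc n))) \<longlonglongrightarrow> 0"
      using tendsto_mult_right_zero[OF LIMSEQ_inverse_real_of_nat] .
    from tendsto_real_sqrt[OF this] show "(\<lambda>n. sqrt (2 / real (Suc n))) \<longlonglongrightarrow> 0"
      by (simp add: divide_inverse del: of_nat_Suc)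
  qed
  then obtain p where p: "y \<longlonglongrightarrow> p"
    using Cauchy_convergent[of y] unfolding convergent_def by blast
  have pS: "p \<in> S"
    using closed_sequentially[OF S(2) y(1) p] .
  have "(\<lambda>n. (norm (x - y n))\<^sup>2) \<longlonglongrightarrow> (norm (x - p))\<^sup>2"
    by (intro tendsto_intros p)
  moreover have "(\<lambda>n. D + inverse (real (Suc n))) \<longlonglongrightarrow> D + 0"
    by (intro tendsto_intros LIMSEQ_inverse_real_of_nat)
  ultimately have pD: "(norm (x - p))\<^sup>2 \<le> D"
    using y(2) by (intro LIMSEQ_le) (auto simp: divide_inverse less_imp_le)
  have "inner (x - p) z = 0" if z: "z \<in> S" for z
  proof (rule ccontr)
    assume nz: "inner (x - p) z \<noteq> 0"
    \<comment> \<open>The minimiser of |x - p - t z|^2 in t; a nonzero inner product would make the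
      distance drop below D.\<close>
    define t where "t = inner (x - p) z / inner z z"
    have zz: "inner z z > 0" using nz by auto
    have "p + t *\<^sub>R z \<in> S" using S(1) pS z by (simp add: subspace_add subspace_scale)
    from D_le[OF this] have "(norm (x - p))\<^sup>2 \<le> (norm (x - p - t *\<^sub>R z))\<^sup>2"
      using pD by (metis diff_diff_eq order_trans)
    also have "\<dots> = (norm (x - p))\<^sup>2 - 2 * t * inner (x - p) z + t * t * inner z z"
      by (simp only: power2_norm_eq_inner inner_diff_left[of "x - p"] inner_diff_right[of _ "x - p"]
          inner_scaleR_left inner_scaleR_right inner_commute[of z "x - p"]) (simp add: algebra_simps)
    finally have "2 * t * inner (x - p) z \<le> t * (t * inner z z)" by simp
    also have "t * inner z z = inner (x - p) z" using zz by (simp add: t_def)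
    finally have "t * inner (x - p) z \<le> 0" by simp
    moreover have "t * inner (x - p) z > 0"
      unfolding t_def times_divide_eq_left
      using zz nz by (intro divide_pos_pos) (auto simp: zero_less_mult_iff linorder_neq_iff)
    ultimately show False by simp
  qed
  with pS show ?thesis by blast
qed

text \<open>Finitely many maps into a finite-dimensional space separate W, so W is
  finite-dimensional and all norms on it are equivalent. Induction on M replaces a dimension
  argument: a right inverse g of \<phi> M splits off one part, and the rest lies in the kernel of
  \<phi> M.\<close>

lemma norm_le_coordinates:
  fixes \<phi> :: "nat \<Rightarrow> 'a::real_normed_vector \<Rightarrow> 'b::euclidean_space"
  assumes \<phi>: "\<And>n. linear (\<phi> n)" and W: "subspace W"
    and sep: "\<And>w. w \<in> W \<Longrightarrow> (\<And>n. n < M \<Longrightarrow> \<phi> n w = 0) \<Longrightarrow> w = 0"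
  shows "\<exists>C\<ge>0. \<forall>w\<in>W. norm w \<le> C * (\<Sum>n<M. norm (\<phi> n w))"
  using W sep
proof (induction M arbitrary: W)
  case 0
  then show ?case by (intro exI[of _ 0]) auto
next
  case (Suc M)
  let ?W = "{w \<in> W. \<phi> M w = 0}"
  have "subspace ?W"
    using Suc.prems(1)
    by (auto simp: subspace_def linear_0[OF \<phi>] linear_add[OF \<phi>] linear_scale[OF \<phi>])
  moreover have "w = 0" if "w \<in> ?W" "\<And>n. n < M \<Longrightarrow> \<phi> n w = 0" for w
    using that Suc.prems(2)[of w] by (auto simp: less_Suc_eq)
  ultimately obtain C where C: "C \<ge> 0" "\<And>w. w \<in> ?W \<Longrightarrow> norm w \<le> C * (\<Sum>n<M. norm (\<phi> n w))"
    using Suc.IH[of ?W] by blast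
  obtain g where g: "range g \<subseteq> W" "linear g" "\<And>v. v \<in> \<phi> M ` W \<Longrightarrow> \<phi> M (g v) = v"
    using linear_exists_right_inverse_on[OF \<phi>[of M] Suc.prems(1)] by auto
  have "bounded_linear g"
    using g(2) by (simp add: linear_conv_bounded_linear)
  then obtain K where K: "K \<ge> 0" "\<And>x. norm (g x) \<le> norm x * K"
    using bounded_linear.nonneg_bounded by metis
  \<comment> \<open>The maps \<phi> n are only assumed linear; their compositions with g are bounded
    since g starts from a finite-dimensional space.\<close>
  have "\<exists>L\<ge>0. \<forall>x. norm (\<phi> n (g x)) \<le> norm x * L" for n
  proof -
    have "linear (\<phi> n \<circ> g)" using g(2) \<phi> by (rule linear_compose)
    then have "bounded_linear (\<phi> n \<circ> g)" by (simp add: linear_conv_bounded_linear)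
    then show ?thesis using bounded_linear.nonneg_bounded by fastforce
  qed
  then obtain L where L: "\<And>n. L n \<ge> 0" "\<And>n x. norm (\<phi> n (g x)) \<le> norm x * L n" by metis
  \<comment> \<open>K pays for the lifted part g (\<phi> M w). The rest pays for the remainder v,
    whose n-th coordinate differs from that of w by at most L n times the norm of \<phi> M
    w.\<close>
  define C' where "C' = K + C * (1 + (\<Sum>n<M. L n))"
  have SL: "(\<Sum>n<M. L n) \<ge> 0" by (simp add: sum_nonneg L)
  have "norm w \<le> C' * (\<Sum>n<Suc M. norm (\<phi> n w))" if w: "w \<in> W" for w
  proof -
    let ?a = "norm (\<phi> M w)" and ?s = "\<Sum>n<M. norm (\<phi> n w)"
    define v where "v = w - g (\<phi> M w)"
    have "\<phi> M v = 0"
      using g(3)[of "\<phi> M w"] w linear_diff[OF \<phi>] by (simp add: v_def)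
    moreover have "v \<in> W"
      using g(1) w Suc.prems(1) by (auto simp: v_def intro!: subspace_diff)
    ultimately have "norm v \<le> C * (\<Sum>n<M. norm (\<phi> n v))" by (intro C(2)) simp
    also have "\<dots> \<le> C * (\<Sum>n<M. norm (\<phi> n w) + ?a * L n)"
    proof (intro mult_left_mono sum_mono C(1))
      fix n
      have "norm (\<phi> n v) \<le> norm (\<phi> n w) + norm (\<phi> n (g (\<phi> M w)))"
        unfolding v_def linear_diff[OF \<phi>] by (rule norm_triangle_ineq4)
      then show "norm (\<phi> n v) \<le> norm (\<phi> n w) + ?a * L n"
        using L(2)[of n "\<phi> M w"] by linarith
    qed
    also have "\<dots> = C * ?s + C * ?a * (\<Sum>n<M. L n)"
      by (simp add: sum.distrib sum_distrib_left[symmetric] distrib_left)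
    finally have "norm v \<le> C * ?s + C * ?a * (\<Sum>n<M. L n)" .
    moreover have "norm w \<le> norm v + norm (g (\<phi> M w))"
      using norm_triangle_ineq[of v "g (\<phi> M w)"] by (simp add: v_def)
    ultimately have "norm w \<le> C * ?s + C * ?a * (\<Sum>n<M. L n) + ?a * K"
      using K(2)[of "\<phi> M w"] by linarith
    also have "\<dots> \<le> C' * ?s + C' * ?a"
    proof -
      have "C * ?s \<le> C' * ?s"
        using K(1) C(1) SL by (intro mult_right_mono) (auto simp: C'_def algebra_simps sum_nonneg)
      moreover have "(C * (\<Sum>n<M. L n) + K) * ?a \<le> C' * ?a"
        using C(1) by (intro mult_right_mono) (auto simp: C'_def algebra_simps)
      ultimately show ?thesis by (simp add: algebra_simps)
    qed
    finally show ?thesis by (simp add: algebra_simps)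
  qed
  moreover have "C' \<ge> 0" using K(1) C(1) SL by (simp add: C'_def)
  ultimately show ?case by blast
qed


subsection \<open>Square-summable sequences as a Hilbert space\<close>

lemma abs_inner_le_sum_squares: "\<bar>inner x y\<bar> \<le> (norm x)\<^sup>2 + (norm y)\<^sup>2"
  for x y :: "'a::real_inner"
proof -
  have "\<bar>inner x y\<bar> \<le> norm x * norm y" by (rule Cauchy_Schwarz_ineq2)
  also have "\<dots> \<le> (norm x)\<^sup>2 + (norm y)\<^sup>2"
    using sum_squares_bound[of "norm x" "norm y"] mult_nonneg_nonneg[of "norm x" "norm y"]
    by (simp del: mult_nonneg_nonneg)
  finally show ?thesis .
qed

lemma l2_add: "u \<in> l2 \<Longrightarrow> v \<in> l2 \<Longrightarrow> u + v \<in> l2"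
proof -
  assume "u \<in> l2" "v \<in> l2"
  then have "summable (\<lambda>n. 2 * (norm (u n))\<^sup>2 + 2 * (norm (v n))\<^sup>2)" "u 0 = 0" "v 0 = 0"
    by (auto simp: l2_def intro!: summable_add summable_mult)
  moreover have "(norm (u n + v n))\<^sup>2 \<le> 2 * (norm (u n))\<^sup>2 + 2 * (norm (v n))\<^sup>2" for n
  proof -
    have "(norm (u n + v n))\<^sup>2 \<le> (norm (u n) + norm (v n))\<^sup>2"
      by (intro power_mono norm_triangle_ineq) simp
    also have "\<dots> \<le> 2 * (norm (u n))\<^sup>2 + 2 * (norm (v n))\<^sup>2"
      using sum_squares_bound[of "norm (u n)" "norm (v n)"] by (simp add: power2_sum)
    finally show ?thesis .
  qed
  ultimately show ?thesis
    unfolding l2_def by (auto intro: summable_comparison_test')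
qed

lemma norm_complex_scale: "norm (c *s x) = cmod c * norm x"
  for x :: "complex^'d"
proof -
  have "norm (c *s x) = L2_set (\<lambda>i. cmod c * norm (x $ i)) UNIV"
    by (simp add: norm_vec_def norm_mult)
  then show ?thesis by (simp add: norm_vec_def L2_set_right_distrib)
qed

lemma l2_scale: "u \<in> l2 \<Longrightarrow> seq_scale c u \<in> l2"
  by (auto simp: l2_def seq_scale_def norm_complex_scale power_mult_distrib summable_mult)

lemma l2_scaleR: "u \<in> l2 \<Longrightarrow> (\<lambda>n. r *\<^sub>R u n) \<in> l2"
  by (auto simp: l2_def power_mult_distrib summable_mult)

lemma l2_uminus: "u \<in> l2 \<Longrightarrow> - u \<in> l2"
  by (auto simp: l2_def)

lemma summable_inner_l2:
  assumes "u \<in> l2" "v \<in> l2"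
  shows "summable (\<lambda>n. inner (u n) (v n))"
proof (rule summable_comparison_test')
  show "summable (\<lambda>n. (norm (u n))\<^sup>2 + (norm (v n))\<^sup>2)"
    using assms by (auto simp: l2_def intro!: summable_add)
qed (simp add: abs_inner_le_sum_squares)

text \<open>A separate type carries the class instances for real inner products and completeness,
  which make topology and orthogonal projection available.\<close>

typedef (overloaded) 'd ell2 = "l2 :: (nat \<Rightarrow> complex^'d::finite) set"
  morphisms seq Abs_ell2
  by (rule exI[of _ 0]) (simp add: l2_def)

setup_lifting type_definition_ell2

lemma seq_0: "seq u 0 = 0"
  using seq[of u] by (simp add: l2_def)

instantiation ell2 :: (finite) real_vector
begin

lift_definition zero_ell2 :: "'a ell2" is 0 by (simp add: l2_def)
lift_definition plus_ell2 :: "'a ell2 \<Rightarrow> 'a ell2 \<Rightarrow> 'a ell2" is "(+)" by (rule l2_add)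
lift_definition uminus_ell2 :: "'a ell2 \<Rightarrow> 'a ell2" is uminus by (rule l2_uminus)
lift_definition minus_ell2 :: "'a ell2 \<Rightarrow> 'a ell2 \<Rightarrow> 'a ell2" is "(-)"
  by (metis l2_add l2_uminus add_uminus_conv_diff)
lift_definition scaleR_ell2 :: "real \<Rightarrow> 'a ell2 \<Rightarrow> 'a ell2" is "\<lambda>r u n. r *\<^sub>R u n"
  by (rule l2_scaleR)

instance
  by standard (transfer; simp add: fun_eq_iff algebra_simps)+

end

instantiation ell2 :: (finite) real_inner
begin

lift_definition inner_ell2 :: "'a ell2 \<Rightarrow> 'a ell2 \<Rightarrow> real" is "\<lambda>u v. \<Sum>n. inner (u n) (v n)" .
definition norm_ell2 :: "'a ell2 \<Rightarrow> real" where "norm_ell2 u = sqrt (inner u u)"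
definition dist_ell2 :: "'a ell2 \<Rightarrow> 'a ell2 \<Rightarrow> real" where "dist_ell2 u v = norm (u - v)"
definition sgn_ell2 :: "'a ell2 \<Rightarrow> 'a ell2" where "sgn_ell2 u = u /\<^sub>R norm u"
definition uniformity_ell2 :: "('a ell2 \<times> 'a ell2) filter" where
  "uniformity_ell2 = (INF e\<in>{0<..}. principal {(x, y). dist x y < e})"
definition open_ell2 :: "'a ell2 set \<Rightarrow> bool" where
  "open_ell2 U \<longleftrightarrow> (\<forall>x\<in>U. eventually (\<lambda>(x', y). x' = x \<longrightarrow> y \<in> U) uniformity)"

instance
proof
  fix u v w :: "'a ell2" and r :: real
  show "dist u v = norm (u - v)" by (rule dist_ell2_def)
  show "sgn u = u /\<^sub>R norm u" by (rule sgn_ell2_def)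
  show "uniformity = (INF e\<in>{0<..}. principal {(x, y :: 'a ell2). dist x y < e})"
    by (rule uniformity_ell2_def)
  show "open U \<longleftrightarrow> (\<forall>x\<in>U. eventually (\<lambda>(x', y). x' = x \<longrightarrow> y \<in> U) uniformity)" for U :: "'a ell2 set"
    by (rule open_ell2_def)
  show "inner u v = inner v u"
    by transfer (simp add: inner_commute)
  show "inner (u + v) w = inner u w + inner v w"
    by transfer (simp add: inner_add_left suminf_add summable_inner_l2)
  show "inner (r *\<^sub>R u) v = r * inner u v"
    by transfer (simp add: suminf_mult summable_inner_l2)
  show "0 \<le> inner u u"
    by transfer (simp add: suminf_nonneg summable_inner_l2)
  show "inner u u = 0 \<longleftrightarrow> u = 0"
    by transfer (simp add: suminf_eq_zero_iff summable_inner_l2 fun_eq_iff)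
  show "norm u = sqrt (inner u u)" by (rule norm_ell2_def)
qed

end

lemma seq_simps:
  "seq (u + v) n = seq u n + seq v n" "seq (u - v) n = seq u n - seq v n"
  "seq (r *\<^sub>R u) n = r *\<^sub>R seq u n" "seq 0 n = 0"
  by (simp_all add: plus_ell2.rep_eq minus_ell2.rep_eq scaleR_ell2.rep_eq zero_ell2.rep_eq)

lemma inner_ell2_sums: "(\<lambda>n. inner (seq u n) (seq v n)) sums inner u v"
  unfolding inner_ell2.rep_eq using summable_inner_l2[OF seq seq] by (rule summable_sums)

lemma norm_ell2_sums: "(\<lambda>n. (norm (seq u n))\<^sup>2) sums (norm u)\<^sup>2"
  using inner_ell2_sums[of u u] by (simp add: dot_square_norm)

lemma norm_ell2_eq_l2_norm: "norm u = l2_norm (seq u)"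
  using norm_ell2_sums[of u] unfolding l2_norm_def by (metis norm_ge_zero real_sqrt_unique sums_unique)

lemma norm_seq_le: "norm (seq u n) \<le> norm u"
proof -
  have "(\<Sum>k\<in>{n}. (norm (seq u k))\<^sup>2) \<le> (norm u)\<^sup>2"
    using norm_ell2_sums[of u] by (metis (no_types) sum_le_suminf sums_iff finite.emptyI finite_insert zero_le_power2)
  then have "(norm (seq u n))\<^sup>2 \<le> (norm u)\<^sup>2" by simp
  then show ?thesis by (rule power2_le_imp_le) simp
qed

lemma bounded_linear_seq: "bounded_linear (\<lambda>u. seq u n)"
  by (rule bounded_linear_intro[of _ 1]) (simp_all add: seq_simps norm_seq_le)

lemma ell2_eqI: "(\<And>n. seq u n = seq v n) \<Longrightarrow> u = v"
  by (metis ext seq_inject)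

text \<open>The limit is taken componentwise. Bounds on finite partial sums survive the limit, are
  uniform in the number of terms, and so give both square-summability and norm convergence.\<close>

instance ell2 :: (finite) complete_space
proof
  fix X :: "nat \<Rightarrow> 'a ell2" assume X: "Cauchy X"
  have "Cauchy (\<lambda>k. seq (X k) n)" for n
    by (rule bounded_linear.Cauchy[OF bounded_linear_seq X])
  then have "\<forall>n. \<exists>l. (\<lambda>k. seq (X k) n) \<longlonglongrightarrow> l"
    using Cauchy_convergent unfolding convergent_def by blast
  then obtain x where x: "\<And>n. (\<lambda>k. seq (X k) n) \<longlonglongrightarrow> x n"
    using choice[of "\<lambda>n l. (\<lambda>k. seq (X k) n) \<longlonglongrightarrow> l"] by blast
  have tail: "(\<Sum>n<m. (norm (seq (X k) n - x n))\<^sup>2) \<le> e\<^sup>2"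
    if XK: "\<And>i j. i \<ge> K \<Longrightarrow> j \<ge> K \<Longrightarrow> norm (X i - X j) < e" and "k \<ge> K" for e K k m
  proof (rule LIMSEQ_le_const2)
    show "(\<lambda>j. \<Sum>n<m. (norm (seq (X k) n - seq (X j) n))\<^sup>2) \<longlonglongrightarrow> (\<Sum>n<m. (norm (seq (X k) n - x n))\<^sup>2)"
      by (intro tendsto_intros x)
    have "(\<Sum>n<m. (norm (seq (X k) n - seq (X j) n))\<^sup>2) \<le> e\<^sup>2" if "j \<ge> K" for j
    proof -
      have "(\<Sum>n<m. (norm (seq (X k - X j) n))\<^sup>2) \<le> (norm (X k - X j))\<^sup>2"
        using norm_ell2_sums[of "X k - X j"]
        by (metis (no_types) sum_le_suminf sums_iff finite_lessThan zero_le_power2)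
      also have "\<dots> \<le> e\<^sup>2"
        using XK[OF \<open>k \<ge> K\<close> that] by (intro power_mono) auto
      finally show ?thesis by (simp add: seq_simps)
    qed
    then show "\<exists>N. \<forall>j\<ge>N. (\<Sum>n<m. (norm (seq (X k) n - seq (X j) n))\<^sup>2) \<le> e\<^sup>2" by blast
  qed
  have diff: "(\<lambda>n. seq (X k) n - x n) \<in> l2"
    if "\<And>i j. i \<ge> K \<Longrightarrow> j \<ge> K \<Longrightarrow> norm (X i - X j) < e" "k \<ge> K" for e K k
  proof -
    have "(\<lambda>k. seq (X k) 0) \<longlonglongrightarrow> 0" by (simp add: seq_0)
    then have "x 0 = 0" using x LIMSEQ_unique by blast
    then show ?thesis
      unfolding l2_def using summableI_nonneg_bounded[of "\<lambda>n. (norm (seq (X k) n - x n))\<^sup>2" "e\<^sup>2"] tail[OF that]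
      by (simp add: seq_0)
  qed
  have "x \<in> l2"
  proof -
    obtain K where K: "\<And>i j. i \<ge> K \<Longrightarrow> j \<ge> K \<Longrightarrow> norm (X i - X j) < 1"
      using CauchyD[OF X, of 1] by auto
    have "seq (X K) + - (\<lambda>n. seq (X K) n - x n) \<in> l2"
      using diff[OF K order_refl] by (intro l2_add l2_uminus seq)
    also have "seq (X K) + - (\<lambda>n. seq (X K) n - x n) = x" by (simp add: fun_eq_iff)
    finally show ?thesis .
  qed
  then obtain u where u: "seq u = x" using Abs_ell2_inverse by blast
  have "X \<longlonglongrightarrow> u"
  proof (rule LIMSEQ_I)
    fix e :: real assume e: "0 < e"
    obtain K where K: "\<And>i j. i \<ge> K \<Longrightarrow> j \<ge> K \<Longrightarrow> norm (X i - X j) < e / 2"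
      using CauchyD[OF X, of "e/2"] e by auto
    have "norm (X k - u) < e" if "k \<ge> K" for k
    proof -
      have sums: "(\<lambda>n. (norm (seq (X k) n - x n))\<^sup>2) sums (norm (X k - u))\<^sup>2"
        using norm_ell2_sums[of "X k - u"] by (simp add: seq_simps u)
      have "(norm (X k - u))\<^sup>2 \<le> (e/2)\<^sup>2"
        unfolding sums_unique[OF sums]
        by (rule suminf_le_const[OF sums_summable[OF sums] tail[OF K that]])
      then have "norm (X k - u) \<le> e/2"
        by (rule power2_le_imp_le) (use e in simp)
      then show ?thesis using e by simp
    qed
    then show "\<exists>no. \<forall>n\<ge>no. norm (X n - u) < e" by blast
  qed
  then show "convergent X" unfolding convergent_def by blast
qed

section \<open>Complex scalars on the sequence space\<close>

lift_definition cscale :: "complex \<Rightarrow> 'd::finite ell2 \<Rightarrow> 'd ell2" is seq_scale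
  by (rule l2_scale)

lemma seq_cscale: "seq (cscale z u) = seq_scale z (seq u)"
  by (rule cscale.rep_eq)

lemma cscale_add: "cscale z (u + v) = cscale z u + cscale z v"
  and cscale_diff: "cscale z (u - v) = cscale z u - cscale z v"
  and cscale_diff_left: "cscale (z - w) u = cscale z u - cscale w u"
  and cscale_cscale: "cscale z (cscale w u) = cscale (z * w) u"
  by (transfer; simp add: seq_scale_def fun_eq_iff vec.scale_right_distrib vec.scale_right_diff_distrib
      vec.scale_left_diff_distrib)+

lemma cscale_of_real: "cscale (complex_of_real r) u = r *\<^sub>R u"
  by transfer (simp add: seq_scale_def complex_of_real_scale_vec)

lemma cscale_zero: "cscale z 0 = 0"
  by transfer (simp add: seq_scale_def fun_eq_iff)

lemma inner_cscale_left: "inner (cscale z u) v = inner u (cscale (cnj z) v)"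
  by transfer (simp add: seq_scale_def inner_complex_scale_left)

lemma norm_cscale: "norm (cscale z u) = cmod z * norm u"
proof -
  have "(norm (cscale z u))\<^sup>2 = inner u (cscale (cnj z * z) u)"
    by (simp add: power2_norm_eq_inner inner_cscale_left cscale_cscale)
  also have "cnj z * z = complex_of_real ((cmod z)\<^sup>2)"
    using complex_norm_square[of z] by (simp add: mult.commute)
  finally have "(norm (cscale z u))\<^sup>2 = (cmod z * norm u)\<^sup>2"
    by (simp only: cscale_of_real inner_scaleR_right power_mult_distrib dot_square_norm)
  then show ?thesis
    by (rule power2_eq_imp_eq) auto
qed

lemma bounded_linear_cscale: "bounded_linear (cscale z)"
proof (rule bounded_linear_intro[of _ "cmod z"])
  fix r u show "cscale z (r *\<^sub>R u) = r *\<^sub>R cscale z u"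
    by (simp add: cscale_of_real[symmetric] cscale_cscale mult.commute)
qed (simp_all add: cscale_add norm_cscale mult.commute)


subsection \<open>Self-adjoint operators\<close>

text \<open>Self-adjointness stated with the real inner product; closure under complex scalars
  recovers the imaginary part. That the graph is its own adjoint makes it additive and
  closed.\<close>

locale self_adjoint_graph =
  fixes T :: "('d::finite ell2 \<times> 'd ell2) set"
  assumes graph_iff: "(v, g) \<in> T \<longleftrightarrow> (\<forall>(u, f)\<in>T. inner f v = inner u g)"
    and graph_cscale: "(u, f) \<in> T \<Longrightarrow> (cscale z u, cscale z f) \<in> T"
begin

lemma graph_symmetric: "(u, f) \<in> T \<Longrightarrow> (v, g) \<in> T \<Longrightarrow> inner f v = inner u g"
  using graph_iff[of v g] by blast

lemma graph_add:
  assumes "(u, f) \<in> T" "(v, g) \<in> T"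
  shows "(u + v, f + g) \<in> T"
proof -
  have "inner k (u + v) = inner h (f + g)" if "(h, k) \<in> T" for h k
    using graph_symmetric[OF that assms(1)] graph_symmetric[OF that assms(2)]
    by (simp add: inner_add_right)
  then show ?thesis by (subst graph_iff) blast
qed

lemma graph_scaleR: "(u, f) \<in> T \<Longrightarrow> (r *\<^sub>R u, r *\<^sub>R f) \<in> T"
  by (metis cscale_of_real graph_cscale)

lemma graph_diff: "(u, f) \<in> T \<Longrightarrow> (v, g) \<in> T \<Longrightarrow> (u - v, f - g) \<in> T"
  using graph_add[of u f "(-1) *\<^sub>R v" "(-1) *\<^sub>R g"] graph_scaleR[of v g "-1"] by simp

lemma graph_zero: "(0, 0) \<in> T"
  by (subst graph_iff) auto

lemma graph_limit:
  assumes T: "\<And>n. (u n, f n) \<in> T" and lim: "u \<longlonglongrightarrow> a" "f \<longlonglongrightarrow> b"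
  shows "(a, b) \<in> T"
proof -
  have "inner k a = inner h b" if hk: "(h, k) \<in> T" for h k
  proof (rule LIMSEQ_unique)
    show "(\<lambda>n. inner k (u n)) \<longlonglongrightarrow> inner k a" by (intro tendsto_intros lim)
    have "(\<lambda>n. inner h (f n)) \<longlonglongrightarrow> inner h b" by (intro tendsto_intros lim)
    then show "(\<lambda>n. inner k (u n)) \<longlonglongrightarrow> inner h b"
      by (simp add: graph_symmetric[OF hk T])
  qed
  then show ?thesis by (subst graph_iff) blast
qed

text \<open>The bound at z makes the range closed. A vector orthogonal to the range lies in the
  domain and is an eigenvector for \<open>cnj z\<close>, which the bound at \<open>cnj z\<close>
  excludes unless it is zero.\<close>

lemma shift_surjective:
  assumes c: "0 < c" and lower: "\<And>u f. (u, f) \<in> T \<Longrightarrow> c * norm u \<le> norm (f - cscale z u)"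
    and lower': "\<And>u f. (u, f) \<in> T \<Longrightarrow> c * norm u \<le> norm (f - cscale (cnj z) u)"
  shows "\<exists>u f. (u, f) \<in> T \<and> g = f - cscale z u"
proof -
  define R where "R = {f - cscale z u |u f. (u, f) \<in> T}"
  have "subspace R"
    unfolding subspace_def
  proof (intro conjI ballI allI)
    have "0 = 0 - cscale z 0" by (simp add: cscale_zero)
    with graph_zero show "0 \<in> R" unfolding R_def by blast
  next
    fix x y assume "x \<in> R" "y \<in> R"
    then obtain u f v h where "(u, f) \<in> T" "(v, h) \<in> T" "x = f - cscale z u" "y = h - cscale z v"
      unfolding R_def by blast
    then have "(u + v, f + h) \<in> T" "x + y = (f + h) - cscale z (u + v)"
      by (auto simp: graph_add cscale_add)
    then show "x + y \<in> R" unfolding R_def by blast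
  next
    fix r x assume "x \<in> R"
    then obtain u f where "(u, f) \<in> T" "x = f - cscale z u"
      unfolding R_def by blast
    then have "(r *\<^sub>R u, r *\<^sub>R f) \<in> T" "r *\<^sub>R x = r *\<^sub>R f - cscale z (r *\<^sub>R u)"
      by (auto simp: graph_scaleR scaleR_diff_right linear_scale[OF bounded_linear.linear[OF bounded_linear_cscale]])
    then show "r *\<^sub>R x \<in> R" unfolding R_def by blast
  qed
  moreover have "closed R"
    unfolding closed_sequential_limits
  proof (intro allI impI, elim conjE)
    fix r l assume r: "\<forall>n. r n \<in> R" "r \<longlonglongrightarrow> l"
    then have "\<forall>n. \<exists>p. p \<in> T \<and> r n = snd p - cscale z (fst p)"
      unfolding R_def by fastforce
    then obtain p where p: "\<And>n. p n \<in> T" "\<And>n. r n = snd (p n) - cscale z (fst (p n))"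
      by metis
    define u where "u n = fst (p n)" for n
    have T: "(u n, r n + cscale z (u n)) \<in> T" for n
      using p[of n] by (simp add: u_def)
    have "Cauchy u"
    proof (rule Cauchy_if_norm_diff_le_null)
      fix m n
      have "c * norm (u m - u n) \<le> norm (r m - r n)"
        using lower[OF graph_diff[OF T[of m] T[of n]]] by (simp add: cscale_diff algebra_simps)
      also have "\<dots> \<le> norm (r m - l) + norm (r n - l)"
        using norm_triangle_ineq4[of "r m - l" "r n - l"] by simp
      finally show "norm (u m - u n) \<le> norm (r m - l) / c + norm (r n - l) / c"
        using c by (simp add: field_simps)
    next
      have "(\<lambda>n. norm (r n - l)) \<longlonglongrightarrow> 0"
        using r(2) by (simp add: LIM_zero_iff tendsto_norm_zero_iff)
      then show "(\<lambda>n. norm (r n - l) / c) \<longlonglongrightarrow> 0"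
        by (rule tendsto_divide_zero)
    qed
    then obtain a where a: "u \<longlonglongrightarrow> a"
      using Cauchy_convergent[of u] unfolding convergent_def by blast
    have "(a, l + cscale z a) \<in> T"
      by (rule graph_limit[OF T a]) (intro tendsto_add r(2) bounded_linear.tendsto[OF bounded_linear_cscale] a)
    moreover have "l = (l + cscale z a) - cscale z a" by simp
    ultimately show "l \<in> R" unfolding R_def by blast
  qed
  ultimately obtain y where y: "y \<in> R" "\<And>x. x \<in> R \<Longrightarrow> inner (g - y) x = 0"
    using orthogonal_projection_exists[of R g] by blast
  define h where "h = g - y"
  have "inner f h = inner u (cscale (cnj z) h)" if "(u, f) \<in> T" for u f
  proof -
    have "f - cscale z u \<in> R" using that unfolding R_def by blast
    from y(2)[OF this] show ?thesis
      by (simp add: h_def[symmetric] inner_diff_right inner_commute[of h] inner_cscale_left)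
  qed
  then have "(h, cscale (cnj z) h) \<in> T"
    by (subst graph_iff) blast
  from lower'[OF this] have "h = 0"
    using c by (simp add: mult_le_0_iff)
  with y(1) show ?thesis
    unfolding h_def R_def by auto
qed

section \<open>Spectral gap around a real point\<close>

definition kernel :: "real \<Rightarrow> 'd ell2 set" where
  "kernel r = {u. (u, r *\<^sub>R u) \<in> T}"

lemma subspace_kernel: "subspace (kernel r)"
proof (rule subspaceI)
  show "0 \<in> kernel r" using graph_zero by (simp add: kernel_def)
  show "u + v \<in> kernel r" if "u \<in> kernel r" "v \<in> kernel r" for u v
    using graph_add[of u "r *\<^sub>R u" v "r *\<^sub>R v"] that by (simp add: kernel_def scaleR_add_right)
  show "s *\<^sub>R u \<in> kernel r" if "u \<in> kernel r" for s u
    using graph_scaleR[of u "r *\<^sub>R u" s] that by (simp add: kernel_def mult.commute)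
qed

lemma cscale_kernel: "u \<in> kernel r \<Longrightarrow> cscale z u \<in> kernel r"
  unfolding kernel_def using graph_cscale[of u "r *\<^sub>R u" z]
  by (simp add: linear_scale[OF bounded_linear.linear[OF bounded_linear_cscale]])

lemma closed_kernel: "closed (kernel r)"
  unfolding closed_sequential_limits
proof (intro allI impI, elim conjE)
  fix u l assume u: "\<forall>n. u n \<in> kernel r" "u \<longlonglongrightarrow> l"
  have T: "(u n, r *\<^sub>R u n) \<in> T" for n using u(1) by (simp add: kernel_def)
  have "(l, r *\<^sub>R l) \<in> T"
    by (rule graph_limit[OF T u(2) tendsto_scaleR[OF tendsto_const u(2)]])
  then show "l \<in> kernel r" by (simp add: kernel_def)
qed

text \<open>Otherwise there are unit vectors u n orthogonal to the kernel with f n - r u n tending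
  to 0. Finitely many coordinates converge along a subsequence, and the a priori estimate upgrades
  this to norm convergence. The limit is a unit vector in the kernel and orthogonal to it.\<close>

lemma gap_orthogonal_to_kernel:
  fixes \<phi> :: "nat \<Rightarrow> 'd ell2 \<Rightarrow> 'b::euclidean_space"
  assumes \<phi>: "\<And>n. bounded_linear (\<phi> n)" and C: "0 \<le> C"
    and apriori: "\<And>u f. (u, f) \<in> T \<Longrightarrow> norm u \<le> C * (norm (f - r *\<^sub>R u) + (\<Sum>n<M. norm (\<phi> n u)))"
  shows "\<exists>c>0. \<forall>(u, f)\<in>T. (\<forall>k\<in>kernel r. inner u k = 0) \<longrightarrow> c * norm u \<le> norm (f - r *\<^sub>R u)"
proof (rule ccontr)
  assume neg: "\<not> ?thesis"
  have "\<exists>p. p \<in> T \<and> norm (fst p) = 1 \<and> (\<forall>k\<in>kernel r. inner (fst p) k = 0)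
      \<and> norm (snd p - r *\<^sub>R fst p) \<le> inverse (real (Suc n))" for n
  proof -
    have "\<not> (\<forall>(u, f)\<in>T. (\<forall>k\<in>kernel r. inner u k = 0) \<longrightarrow> inverse (real (Suc n)) * norm u \<le> norm (f - r *\<^sub>R u))"
    proof
      assume "\<forall>(u, f)\<in>T. (\<forall>k\<in>kernel r. inner u k = 0) \<longrightarrow> inverse (real (Suc n)) * norm u \<le> norm (f - r *\<^sub>R u)"
      moreover have "0 < inverse (real (Suc n))" by simp
      ultimately show False using neg by blast
    qed
    then obtain u f where uf: "(u, f) \<in> T" "\<forall>k\<in>kernel r. inner u k = 0"
      "norm (f - r *\<^sub>R u) < inverse (real (Suc n)) * norm u"
      by (auto simp: not_le[symmetric] simp del: of_nat_Suc)
    have nz: "norm u > 0"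
      using uf(3) by (metis less_irrefl mult_zero_right norm_ge_zero order_le_less_trans zero_less_norm_iff norm_zero)
    let ?s = "inverse (norm u)"
    have "norm (?s *\<^sub>R f - r *\<^sub>R (?s *\<^sub>R u)) = ?s * norm (f - r *\<^sub>R u)"
      using nz by (simp add: scaleR_left_commute[of r] scaleR_diff_right[symmetric] del: scaleR_scaleR)
    also have "\<dots> \<le> ?s * (inverse (real (Suc n)) * norm u)"
      using uf(3) nz by (intro mult_left_mono) auto
    also have "\<dots> = inverse (real (Suc n))"
      using nz by simp
    finally show ?thesis
      using nz uf graph_scaleR[OF uf(1), of ?s]
      by (intro exI[of _ "(?s *\<^sub>R u, ?s *\<^sub>R f)"]) simp
  qed
  then obtain p where p: "\<And>n. p n \<in> T" "\<And>n. norm (fst (p n)) = 1"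
    "\<And>n k. k \<in> kernel r \<Longrightarrow> inner (fst (p n)) k = 0"
    "\<And>n. norm (snd (p n) - r *\<^sub>R fst (p n)) \<le> inverse (real (Suc n))"
    by metis
  define u f where "u n = fst (p n)" and "f n = snd (p n)" for n
  have T: "(u n, f n) \<in> T" for n using p(1)[of n] by (simp add: u_def f_def)
  have bnd: "bounded ((\<lambda>x. x k) ` range (\<lambda>n i. \<phi> i (u n)))" for k
  proof -
    obtain K where K: "\<And>x. norm (\<phi> k x) \<le> norm x * K"
      using bounded_linear.bounded[OF \<phi>] by blast
    show ?thesis
      unfolding bounded_iff using K[of "u _"] p(2) by (intro exI[of _ K]) (auto simp: u_def)
  qed
  \<comment> \<open>Bolzano-Weierstrass for the M coordinates simultaneously.\<close>
  have "\<forall>d\<subseteq>{..<M}. \<exists>l s. strict_mono s \<and>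
      (\<forall>e>0. eventually (\<lambda>n. \<forall>i\<in>d. dist (\<phi> i (u (s n))) (l i) < e) sequentially)"
    using compact_lemma_general[where proj = "\<lambda>x k. x k" and unproj = "\<lambda>x. x" and basis = "{..<M}"
        and f = "\<lambda>n i. \<phi> i (u n)"] bnd by auto
  from this[rule_format, OF order_refl] obtain l s where s: "strict_mono s"
    and l: "\<And>e. e > 0 \<Longrightarrow> eventually (\<lambda>n. \<forall>i\<in>{..<M}. dist (\<phi> i (u (s n))) (l i) < e) sequentially"
    by blast
  \<comment> \<open>The estimate for the difference of two terms separates into a m + a n once the
    limits l i are inserted.\<close>
  define a where "a n = C * (norm (f (s n) - r *\<^sub>R u (s n)) + (\<Sum>i<M. norm (\<phi> i (u (s n)) - l i)))" for n
  have fu: "(\<lambda>n. f n - r *\<^sub>R u n) \<longlonglongrightarrow> 0"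
    by (rule Lim_null_comparison[OF _ LIMSEQ_inverse_real_of_nat])
      (use p(4) in \<open>simp add: u_def f_def\<close>)
  have fus: "(\<lambda>n. f (s n) - r *\<^sub>R u (s n)) \<longlonglongrightarrow> 0"
    using LIMSEQ_subseq_LIMSEQ[OF fu s] by (simp add: o_def)
  have "(\<lambda>n. \<phi> i (u (s n))) \<longlonglongrightarrow> l i" if "i < M" for i
    unfolding tendsto_iff
  proof (intro allI impI)
    fix e :: real assume "0 < e"
    from l[OF this] show "\<forall>\<^sub>F n in sequentially. dist (\<phi> i (u (s n))) (l i) < e"
      by (rule eventually_mono) (use that in auto)
  qed
  then have "(\<lambda>n. norm (\<phi> i (u (s n)) - l i)) \<longlonglongrightarrow> 0" if "i < M" for i
    using that by (simp add: LIM_zero_iff tendsto_norm_zero_iff)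
  then have "(\<lambda>n. \<Sum>i<M. norm (\<phi> i (u (s n)) - l i)) \<longlonglongrightarrow> 0"
    by (intro tendsto_null_sum) auto
  then have a0: "a \<longlonglongrightarrow> 0"
    unfolding a_def by (intro tendsto_mult_right_zero tendsto_add_zero tendsto_norm_zero fus)
  have "Cauchy (\<lambda>n. u (s n))"
  proof (rule Cauchy_if_norm_diff_le_null[OF _ a0])
    fix m n
    let ?m = "s m" and ?n = "s n"
    have "norm (u ?m - u ?n) \<le> C * (norm ((f ?m - f ?n) - r *\<^sub>R (u ?m - u ?n)) + (\<Sum>i<M. norm (\<phi> i (u ?m - u ?n))))"
      using apriori[OF graph_diff[OF T T]] .
    also have "\<dots> \<le> C * ((norm (f ?m - r *\<^sub>R u ?m) + norm (f ?n - r *\<^sub>R u ?n))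
        + (\<Sum>i<M. norm (\<phi> i (u ?m) - l i) + norm (\<phi> i (u ?n) - l i)))"
    proof (intro mult_left_mono add_mono sum_mono C)
      show "norm ((f ?m - f ?n) - r *\<^sub>R (u ?m - u ?n)) \<le> norm (f ?m - r *\<^sub>R u ?m) + norm (f ?n - r *\<^sub>R u ?n)"
        using norm_triangle_ineq4[of "f ?m - r *\<^sub>R u ?m" "f ?n - r *\<^sub>R u ?n"]
        by (simp add: algebra_simps)
      fix i
      show "norm (\<phi> i (u ?m - u ?n)) \<le> norm (\<phi> i (u ?m) - l i) + norm (\<phi> i (u ?n) - l i)"
        using norm_triangle_ineq4[of "\<phi> i (u ?m) - l i" "\<phi> i (u ?n) - l i"]
        by (simp add: linear_diff[OF bounded_linear.linear[OF \<phi>]])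
    qed
    also have "\<dots> = a m + a n"
      by (simp add: a_def sum.distrib algebra_simps)
    finally show "norm (u ?m - u ?n) \<le> a m + a n" .
  qed
  then obtain b where b: "(\<lambda>n. u (s n)) \<longlonglongrightarrow> b"
    using Cauchy_convergent unfolding convergent_def by blast
  have "(\<lambda>n. (f (s n) - r *\<^sub>R u (s n)) + r *\<^sub>R u (s n)) \<longlonglongrightarrow> 0 + r *\<^sub>R b"
    by (intro tendsto_intros fus b)
  then have "(b, r *\<^sub>R b) \<in> T"
    by (intro graph_limit[OF T b]) simp
  then have "b \<in> kernel r" by (simp add: kernel_def)
  then have "(\<lambda>n. inner (u (s n)) b) \<longlonglongrightarrow> 0"
    using p(3) by (simp add: u_def)
  moreover have "(\<lambda>n. inner (u (s n)) b) \<longlonglongrightarrow> inner b b"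
    by (intro tendsto_intros b)
  ultimately have "b = 0"
    using LIMSEQ_unique inner_eq_zero_iff by blast
  moreover have "(\<lambda>n. norm (u (s n))) \<longlonglongrightarrow> norm b"
    by (intro tendsto_intros b)
  then have "norm b = 1"
    using p(2) by (simp add: u_def LIMSEQ_const_iff)
  ultimately show False by simp
qed

text \<open>Split u into its kernel part u0 and the orthogonal part u1. On u0 the shifted operator
  is multiplication by w = r - z; on u1 the gap c absorbs w, leaving c / 2. The two images remain
  orthogonal, so the bounds combine by Pythagoras.\<close>

lemma shift_lower_bound_near:
  assumes c: "0 < c" and gap: "\<And>u f. (u, f) \<in> T \<Longrightarrow> (\<And>k. k \<in> kernel r \<Longrightarrow> inner u k = 0)
      \<Longrightarrow> c * norm u \<le> norm (f - r *\<^sub>R u)"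
    and z: "cmod (z - complex_of_real r) \<le> c / 2" and T: "(u, f) \<in> T"
  shows "min (cmod (z - complex_of_real r)) (c / 2) * norm u \<le> norm (f - cscale z u)"
proof -
  define w where "w = complex_of_real r - z"
  define m where "m = min (cmod w) (c / 2)"
  obtain u0 where u0: "u0 \<in> kernel r" "\<And>k. k \<in> kernel r \<Longrightarrow> inner (u - u0) k = 0"
    using orthogonal_projection_exists[OF subspace_kernel closed_kernel] by blast
  define u1 f1 where "u1 = u - u0" and "f1 = f - r *\<^sub>R u0"
  have T1: "(u1, f1) \<in> T"
    using graph_diff[OF T, of u0 "r *\<^sub>R u0"] u0(1) by (simp add: u1_def f1_def kernel_def)
  have orth1: "inner u1 k = 0" if "k \<in> kernel r" for k
    using u0(2)[OF that] by (simp add: u1_def)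
  define g where "g = (f1 - r *\<^sub>R u1) + cscale w u1"
  have decomp: "f - cscale z u = cscale w u0 + g"
    by (simp add: g_def w_def u1_def f1_def cscale_diff cscale_diff_left cscale_of_real algebra_simps)
  \<comment> \<open>Symmetry keeps f1 orthogonal to the kernel, and since the kernel is closed under
    complex scalars, so is the term with w.\<close>
  have orth: "inner g k = 0" if k: "k \<in> kernel r" for k
  proof -
    have "inner f1 k = inner u1 (r *\<^sub>R k)"
      using graph_symmetric[OF T1] k by (simp add: kernel_def)
    then show ?thesis
      using orth1[OF k] orth1[OF cscale_kernel[OF k]]
      by (simp add: g_def inner_add_left inner_diff_left inner_cscale_left)
  qed
  have m: "0 \<le> m" "m \<le> cmod w" "m \<le> c / 2" using c by (auto simp: m_def)
  have "c * norm u1 \<le> norm (f1 - r *\<^sub>R u1)"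
    using gap[OF T1 orth1] .
  also have "\<dots> \<le> norm g + norm (cscale w u1)"
    using norm_triangle_ineq4[of g "cscale w u1"] by (simp add: g_def)
  also have "norm (cscale w u1) \<le> c / 2 * norm u1"
    unfolding norm_cscale using z by (intro mult_right_mono) (auto simp: w_def norm_minus_commute)
  finally have "c / 2 * norm u1 \<le> norm g" by simp
  then have g: "m * norm u1 \<le> norm g"
    using mult_right_mono[OF m(3), of "norm u1"] by simp
  have "(m * norm u)\<^sup>2 = (m * norm u0)\<^sup>2 + (m * norm u1)\<^sup>2"
  proof -
    have "u = u0 + u1" by (simp add: u1_def)
    then have "(norm u)\<^sup>2 = (norm u0)\<^sup>2 + (norm u1)\<^sup>2"
      using orth1[OF u0(1)] by (simp add: power2_norm_eq_inner inner_add_left inner_add_right inner_commute)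
    then show ?thesis by (simp add: power_mult_distrib algebra_simps)
  qed
  also have "\<dots> \<le> (norm (cscale w u0))\<^sup>2 + (norm g)\<^sup>2"
    using g m by (intro add_mono power_mono) (auto simp: norm_cscale mult_right_mono)
  also have "\<dots> = (norm (f - cscale z u))\<^sup>2"
    using orth[OF cscale_kernel[OF u0(1)], of w]
    by (simp add: decomp power2_norm_eq_inner inner_add_left inner_add_right inner_commute)
  finally have "m * norm u \<le> norm (f - cscale z u)"
    by (rule power2_le_imp_le) simp
  then show ?thesis
    by (simp add: m_def w_def norm_minus_commute)
qed

end


subsection \<open>Self-adjoint operators in the sequence space\<close>

lemma l2_inner_seq: "l2_inner (seq u) (seq v) = Complex (inner u v) (inner u (cscale \<i> v))"
proof -
  have "(\<lambda>n. cinner (seq u n) (seq v n)) sums Complex (inner u v) (inner u (cscale \<i> v))"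
    unfolding sums_complex_iff
    using inner_ell2_sums[of u v] inner_ell2_sums[of u "cscale \<i> v"]
    by (simp add: Re_cinner Im_cinner seq_cscale seq_scale_def)
  then show ?thesis
    unfolding l2_inner_def by (rule sums_unique[symmetric])
qed

lemma seq_eqI: "x \<in> l2 \<Longrightarrow> \<exists>u. seq u = x"
  using Abs_ell2_inverse by blast

locale self_adjoint_operator =
  fixes J :: "'d::finite seq_op"
  assumes self_adjoint: "self_adjoint J"
begin

definition graph :: "('d ell2 \<times> 'd ell2) set" where
  "graph = {(u, f). (seq u, seq f) \<in> J}"

lemma mem_J_iff: "(x, y) \<in> J \<longleftrightarrow> (\<exists>u f. (u, f) \<in> graph \<and> x = seq u \<and> y = seq f)"
proof -
  have "J \<subseteq> l2 \<times> l2"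
    using self_adjoint by (simp add: self_adjoint_def linear_operator_def)
  then show ?thesis
    unfolding graph_def by (blast dest: seq_eqI)
qed

lemma graph_seq_scale: "(u, f) \<in> graph \<Longrightarrow> (cscale z u, cscale z f) \<in> graph"
  using self_adjoint by (simp add: graph_def self_adjoint_def linear_operator_def seq_cscale)

text \<open>The real identity applied to (-\<i> u, -\<i> f) supplies the imaginary part of the
  complex one.\<close>

lemma mem_graph_iff: "(v, g) \<in> graph \<longleftrightarrow> (\<forall>(u, f)\<in>graph. inner f v = inner u g)"
proof -
  have "(v, g) \<in> graph \<longleftrightarrow> (seq v, seq g) \<in> op_adjoint J"
    using self_adjoint by (simp add: graph_def self_adjoint_def)
  also have "\<dots> \<longleftrightarrow> (\<forall>(x, y)\<in>J. l2_inner y (seq v) = l2_inner x (seq g))"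
    by (simp add: op_adjoint_def seq)
  also have "\<dots> \<longleftrightarrow> (\<forall>(u, f)\<in>graph. l2_inner (seq f) (seq v) = l2_inner (seq u) (seq g))"
    unfolding Ball_def using mem_J_iff by fastforce
  also have "\<dots> \<longleftrightarrow> (\<forall>(u, f)\<in>graph. inner f v = inner u g)"
  proof
    assume *: "\<forall>(u, f)\<in>graph. inner f v = inner u g"
    have "inner f v = inner u g \<and> inner f (cscale \<i> v) = inner u (cscale \<i> g)" if "(u, f) \<in> graph" for u f
    proof -
      have "inner (cscale (- \<i>) f) v = inner (cscale (- \<i>) u) g"
        using * graph_seq_scale[OF that, of "- \<i>"] by blast
      then show ?thesis
        using * that by (auto simp: inner_cscale_left)
    qed
    then show "\<forall>(u, f)\<in>graph. l2_inner (seq f) (seq v) = l2_inner (seq u) (seq g)"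
      unfolding l2_inner_seq by auto
  qed (auto simp: l2_inner_seq)
  finally show ?thesis .
qed

sublocale self_adjoint_graph graph
  by unfold_locales (rule mem_graph_iff, rule graph_seq_scale)

lemma mem_op_shift_iff:
  "(x, y) \<in> op_shift J z \<longleftrightarrow> (\<exists>u f. (u, f) \<in> graph \<and> x = seq u \<and> y = seq (f - cscale z u))"
  unfolding op_shift_def
  by (auto simp: mem_J_iff minus_ell2.rep_eq seq_cscale)

lemma mem_resolvent_setI:
  assumes c: "0 < c" and lower: "\<And>u f. (u, f) \<in> graph \<Longrightarrow> c * norm u \<le> norm (f - cscale z u)"
    and lower': "\<And>u f. (u, f) \<in> graph \<Longrightarrow> c * norm u \<le> norm (f - cscale (cnj z) u)"
  shows "z \<in> resolvent_set J"
  unfolding resolvent_set_def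
proof (intro CollectI conjI ballI)
  fix y :: "nat \<Rightarrow> complex^'d" assume "y \<in> l2"
  then obtain g where g: "y = seq g" using seq_eqI by metis
  obtain u f where uf: "(u, f) \<in> graph" "g = f - cscale z u"
    using shift_surjective[OF c lower lower'] by blast
  show "\<exists>!x. (x, y) \<in> op_shift J z"
  proof (rule ex1I)
    show "(seq u, y) \<in> op_shift J z"
      using uf g by (auto simp: mem_op_shift_iff)
    fix x assume "(x, y) \<in> op_shift J z"
    then obtain v h where vh: "(v, h) \<in> graph" "x = seq v" "y = seq (h - cscale z v)"
      by (auto simp: mem_op_shift_iff)
    have "h - cscale z v = f - cscale z u"
      using vh(3) uf(2) g by (simp add: seq_inject)
    then have "(h - f) - cscale z (v - u) = 0"
      by (simp add: cscale_diff algebra_simps)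
    then have "c * norm (v - u) \<le> 0"
      using lower[OF graph_diff[OF vh(1) uf(1)]] by simp
    then show "x = seq u"
      using c vh(2) by (simp add: mult_le_0_iff)
  qed
next
  have "l2_norm x \<le> (1 / c) * l2_norm y" if "(x, y) \<in> op_shift J z" for x y
  proof -
    obtain u f where "(u, f) \<in> graph" "x = seq u" "y = seq (f - cscale z u)"
      using \<open>(x, y) \<in> op_shift J z\<close> by (auto simp: mem_op_shift_iff)
    then show ?thesis
      using lower[of u f] c by (simp add: norm_ell2_eq_l2_norm[symmetric] field_simps)
  qed
  then show "\<exists>C. \<forall>(x, y)\<in>op_shift J z. l2_norm x \<le> C * l2_norm y" by blast
qed

lemma mem_op_eigenspace_iff: "x \<in> op_eigenspace J (complex_of_real r) \<longleftrightarrow> (\<exists>u\<in>kernel r. x = seq u)"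
proof
  assume "x \<in> op_eigenspace J (complex_of_real r)"
  then obtain u f where uf: "(u, f) \<in> graph" "x = seq u" "seq_scale (complex_of_real r) x = seq f"
    by (auto simp: op_eigenspace_def mem_J_iff)
  then have "f = r *\<^sub>R u"
    by (metis cscale_of_real seq_cscale seq_inject)
  then show "\<exists>u\<in>kernel r. x = seq u" using uf by (auto simp: kernel_def)
next
  assume "\<exists>u\<in>kernel r. x = seq u"
  then obtain u where "(u, cscale (complex_of_real r) u) \<in> graph" "x = seq u"
    by (auto simp: kernel_def cscale_of_real)
  then show "x \<in> op_eigenspace J (complex_of_real r)"
    by (simp add: op_eigenspace_def graph_def seq_cscale)
qed

text \<open>With a trivial kernel the gap holds on the whole domain and puts r into the resolvent
  set. In any case every other point within c / 2 of r has a positive lower bound and belongs to the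
  resolvent set.\<close>

lemma spectrum_isolated_eigenvalue:
  fixes \<phi> :: "nat \<Rightarrow> 'd ell2 \<Rightarrow> 'b::euclidean_space"
  assumes \<phi>: "\<And>n. bounded_linear (\<phi> n)" and C: "0 \<le> C"
    and apriori: "\<And>u f. (u, f) \<in> graph \<Longrightarrow> norm u \<le> C * (norm (f - r *\<^sub>R u) + (\<Sum>n<M. norm (\<phi> n u)))"
    and spec: "complex_of_real r \<in> op_spectrum J"
  shows "complex_of_real r isolated_in op_spectrum J" and "op_eigenspace J (complex_of_real r) \<noteq> {0}"
proof -
  let ?z = "complex_of_real r"
  obtain c where c: "0 < c" and gap: "\<And>u f. (u, f) \<in> graph \<Longrightarrow> (\<And>k. k \<in> kernel r \<Longrightarrow> inner u k = 0)
      \<Longrightarrow> c * norm u \<le> norm (f - r *\<^sub>R u)"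
    using gap_orthogonal_to_kernel[OF \<phi> C apriori] by blast
  show "op_eigenspace J ?z \<noteq> {0}"
  proof
    assume triv: "op_eigenspace J ?z = {0}"
    have ker: "u = 0" if "u \<in> kernel r" for u
      using that triv mem_op_eigenspace_iff[of "seq u" r] zero_ell2.rep_eq seq_inject
      by (metis singletonD)
    have "c * norm u \<le> norm (f - r *\<^sub>R u)" if "(u, f) \<in> graph" for u f
    proof (rule gap[OF that])
      show "inner u k = 0" if "k \<in> kernel r" for k using ker[OF that] by simp
    qed
    then have "?z \<in> resolvent_set J"
      by (intro mem_resolvent_setI[OF c]) (simp_all add: cscale_of_real)
    then show False using spec by (simp add: op_spectrum_def)
  qed
  have "w = ?z" if w: "w \<in> op_spectrum J" "dist ?z w < c / 2" for w
  proof (rule ccontr)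
    assume ne: "w \<noteq> ?z"
    define m where "m = min (cmod (w - ?z)) (c / 2)"
    \<comment> \<open>Surjectivity at w requires a lower bound at \<open>cnj w\<close> as well; both
      points have the same distance to the real number r.\<close>
    have cnj: "cmod (cnj w - ?z) = cmod (w - ?z)"
      by (metis complex_cnj_complex_of_real complex_cnj_diff complex_mod_cnj)
    have le: "cmod (w - ?z) \<le> c / 2"
      using w(2) by (simp add: dist_norm norm_minus_commute)
    have "0 < m" using ne c by (simp add: m_def)
    then have "w \<in> resolvent_set J"
    proof (rule mem_resolvent_setI)
      fix u f assume uf: "(u, f) \<in> graph"
      show "m * norm u \<le> norm (f - cscale w u)"
        unfolding m_def by (rule shift_lower_bound_near[OF c gap le uf])
      show "m * norm u \<le> norm (f - cscale (cnj w) u)"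
        unfolding m_def cnj[symmetric] by (rule shift_lower_bound_near[OF c gap le[folded cnj] uf])
    qed
    then show False using w(1) by (simp add: op_spectrum_def)
  qed
  then show "?z isolated_in op_spectrum J"
    unfolding isolated_in_dist_Ex_iff using spec c by (intro conjI exI[of _ "c / 2"]) auto
qed

end


subsection \<open>Self-adjoint extensions of block Jacobi operators\<close>

text \<open>The convention x 0 = 0 absorbs the first row: at n = 1 the additional term contains x
  0.\<close>

lemma jacobi_eq:
  "x 0 = 0 \<Longrightarrow> n \<ge> 1 \<Longrightarrow>
    jacobi A B x n = conj_transpose (A (n - 1)) *v x (n - 1) + B n *v x n + A n *v x (Suc n)"
  by (cases "n = 1") (auto simp: jacobi_def numeral_2_eq_2)

text \<open>Formal symmetry tested on a vector supported at a single index. Its image lives on three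
  neighbouring indices, so the pairing with an arbitrary x is a finite sum.\<close>

lemma jacobi_delta_sums:
  fixes x :: "nat \<Rightarrow> complex^'d::finite"
  assumes herm: "hermitian (B n)" and n: "n \<ge> 1" and x: "x 0 = 0"
  shows "(\<lambda>k. inner (jacobi A B (\<lambda>j. if j = n then e else 0) k) (x k)) sums inner e (jacobi A B x n)"
proof -
  let ?d = "\<lambda>j. if j = n then e else 0"
  obtain m where m: "n = Suc m" using n by (cases n) auto
  have d0: "?d 0 = 0" using n by simp
  have jd: "jacobi A B ?d k = conj_transpose (A (k - 1)) *v ?d (k - 1) + B k *v ?d k + A k *v ?d (Suc k)"
    if "k \<ge> 1" for k
    using jacobi_eq[of ?d k A B, OF d0 that] .
  have "(\<lambda>k. inner (jacobi A B ?d k) (x k)) sums (\<Sum>k\<in>{m, Suc m, Suc (Suc m)}. inner (jacobi A B ?d k) (x k))"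
  proof (rule sums_finite)
    fix k assume k: "k \<notin> {m, Suc m, Suc (Suc m)}"
    show "inner (jacobi A B ?d k) (x k) = 0"
      using k jd[of k] x by (cases "k = 0") (auto simp: m)
  qed simp
  also have "(\<Sum>k\<in>{m, Suc m, Suc (Suc m)}. inner (jacobi A B ?d k) (x k))
      = inner (A m *v e) (x m) + inner (B n *v e) (x n) + inner (conj_transpose (A n) *v e) (x (Suc n))"
    \<comment> \<open>For m = 0 the term with \<open>A 0\<close> is paired with x 0 = 0.\<close>
    using jd[of m] jd[of "Suc m"] jd[of "Suc (Suc m)"] x by (cases "m = 0") (auto simp: m)
  also have "\<dots> = inner e (jacobi A B x n)"
    using jacobi_eq[of x n A B, OF x n] herm[unfolded hermitian_def]
    by (simp add: m inner_add_right inner_conj_transpose conj_transpose_conj_transpose)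
  finally show ?thesis .
qed

lemma jacobi_finite_support:
  assumes "x 0 = 0" "finite {n. x n \<noteq> 0}"
  obtains K where "\<And>n. n \<ge> K \<Longrightarrow> x n = 0" "\<And>n. n \<ge> K \<Longrightarrow> jacobi A B x n = 0" "K \<ge> 1"
proof -
  obtain K where K: "\<And>n. x n \<noteq> 0 \<Longrightarrow> n \<le> K"
    using assms(2) finite_nat_set_iff_bounded_le by auto
  have "x n = 0" if "n > K" for n using K[of n] that by auto
  then show ?thesis
    using jacobi_eq[of x _ A B, OF assms(1)] by (intro that[of "K + 2"]) auto
qed

text \<open>The equation at m > N determines A m x (m + 1) from the two preceding components, and A
  m is injective. Starting requires zeros at both N and N + 1.\<close>

lemma jacobi_unique_continuation:
  assumes inv: "\<And>n. n \<ge> 1 \<Longrightarrow> invertible (A n)"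
    and x0: "\<And>n. n \<le> Suc N \<Longrightarrow> x n = 0" and eq: "\<And>n. n > N \<Longrightarrow> jacobi A B x n = r *\<^sub>R x n"
  shows "x n = 0"
proof (induction n rule: less_induct)
  case (less n)
  show ?case
  proof (cases "n \<le> Suc N")
    case False
    then obtain m where m: "n = Suc m" "m > N" "m \<ge> 1" by (cases n) auto
    have "jacobi A B x m = A m *v x n"
      using jacobi_eq[of x m A B] x0[of 0] less.IH[of m] less.IH[of "m - 1"] m by simp
    then have "A m *v x n = 0"
      using eq[OF m(2)] less.IH[of m] m(1) by simp
    then show ?thesis
      using inv[OF m(3)] unfolding invertible_left_inverse matrix_left_invertible_ker by blast
  qed (rule x0)
qed

locale jacobi_extension = self_adjoint_operator J for J :: "'d::finite seq_op" +
  fixes A B :: "nat \<Rightarrow> complex^'d^'d"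
  assumes hermitian_B: "n \<ge> 1 \<Longrightarrow> hermitian (B n)"
    and invertible_A: "n \<ge> 1 \<Longrightarrow> invertible (A n)"
    and extension: "jacobi_min A B \<subseteq> J"
begin

lemma finite_support_in_graph:
  assumes "x 0 = 0" "finite {n. x n \<noteq> 0}"
  obtains u f where "(u, f) \<in> graph" "seq u = x" "seq f = jacobi A B x"
proof -
  have "(x, jacobi A B x) \<in> J"
    using extension assms unfolding jacobi_min_def by blast
  then show ?thesis using that by (auto simp: mem_J_iff)
qed

lemma delta_in_graph:
  assumes n: "n \<ge> 1"
  obtains u f where "(u, f) \<in> graph" "seq u = (\<lambda>j. if j = n then e else 0)"
    "\<And>v. inner u v = inner e (seq v n)" "\<And>v. inner f v = inner e (jacobi A B (seq v) n)"
proof -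
  let ?d = "\<lambda>j. if j = n then e else 0"
  have "?d 0 = 0" using n by simp
  moreover have "finite {j. ?d j \<noteq> 0}"
    by (rule finite_subset[of _ "{n}"]) auto
  ultimately obtain u f where uf: "(u, f) \<in> graph" "seq u = ?d" "seq f = jacobi A B ?d"
    by (rule finite_support_in_graph)
  have "inner u v = inner e (seq v n)" for v
  proof -
    have "(\<lambda>k. inner (?d k) (seq v k)) sums (\<Sum>k\<in>{n}. inner (?d k) (seq v k))"
      by (rule sums_finite) auto
    then show ?thesis
      using inner_ell2_sums[of u v] unfolding uf(2) by (simp add: sums_unique2)
  qed
  moreover have "inner f v = inner e (jacobi A B (seq v) n)" for v
    using inner_ell2_sums[of f v] jacobi_delta_sums[of B n "seq v" A e, OF hermitian_B[OF n] n seq_0]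
    unfolding uf(3) by (rule sums_unique2)
  ultimately show ?thesis using uf that by blast
qed

text \<open>A self-adjoint extension is contained in the adjoint of the minimal operator; symmetry
  against single-index vectors reads off each component.\<close>

lemma graph_jacobi:
  assumes uf: "(u, f) \<in> graph" and n: "n \<ge> 1"
  shows "seq f n = jacobi A B (seq u) n"
proof -
  have "inner e (seq f n) = inner e (jacobi A B (seq u) n)" for e
  proof -
    obtain d h where "(d, h) \<in> graph" "\<And>v. inner d v = inner e (seq v n)"
      "\<And>v. inner h v = inner e (jacobi A B (seq v) n)"
      by (rule delta_in_graph[OF n, of e]) blast
    then show ?thesis using graph_symmetric[OF _ uf, of d h] by simp
  qed
  then show ?thesis
    by (metis eq_iff_diff_eq_0 inner_diff_right inner_eq_zero_iff)
qed

lemma graph_eigenvector_zero: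
  assumes "(u, r *\<^sub>R u) \<in> graph" "seq u 1 = 0"
  shows "u = 0"
proof -
  have "seq u n = 0" for n
  proof (rule jacobi_unique_continuation[where N = 0])
    show "seq u n = 0" if "n \<le> Suc 0" for n
      using that assms(2) seq_0 by (cases n) auto
    show "jacobi A B (seq u) n = r *\<^sub>R seq u n" if "n > 0" for n
      using graph_jacobi[OF assms(1), of n] that by (simp add: seq_simps)
  qed (rule invertible_A)
  then show ?thesis by (intro ell2_eqI) (simp add: seq_simps)
qed

lemma finite_dim_op_eigenspace:
  "\<exists>F. finite F \<and> op_eigenspace J (complex_of_real r) \<subseteq> vseq.span F"
proof -
  interpret vector_space_pair seq_scale "(*s) :: complex \<Rightarrow> complex^'d \<Rightarrow> _" ..
  let ?E = "op_eigenspace J (complex_of_real r)"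
  let ?p = "\<lambda>x :: nat \<Rightarrow> complex^'d. x 1"
  have J: "(0, 0) \<in> J" "\<And>u f v g. (u, f) \<in> J \<Longrightarrow> (v, g) \<in> J \<Longrightarrow> (u + v, f + g) \<in> J"
    "\<And>c u f. (u, f) \<in> J \<Longrightarrow> (seq_scale c u, seq_scale c f) \<in> J"
    using self_adjoint by (simp_all add: self_adjoint_def linear_operator_def)
  have E: "vseq.subspace ?E"
  proof (rule vseq.subspaceI)
    show "0 \<in> ?E" using J(1) by (simp add: op_eigenspace_def)
    show "x + y \<in> ?E" if "x \<in> ?E" "y \<in> ?E" for x y
      using that J(2)[of x _ y] by (simp add: op_eigenspace_def vseq.scale_right_distrib)
    show "seq_scale c x \<in> ?E" if "x \<in> ?E" for c x
      using that J(3)[of x "seq_scale (complex_of_real r) x" c] by (simp add: op_eigenspace_def mult.commute)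
  qed
  \<comment> \<open>A basis of the eigenspace is mapped injectively by the first component to an
    independent family, which is finite.\<close>
  obtain F where F: "F \<subseteq> ?E" "vseq.independent F" "?E \<subseteq> vseq.span F"
    using vseq.maximal_independent_subset by blast
  have lin: "Vector_Spaces.linear seq_scale (*s) ?p"
    by unfold_locales (auto simp: seq_scale_def vec.scale_right_distrib vec.scale_left_distrib)
  have "vseq.span F \<subseteq> ?E" using F(1) E by (rule vseq.span_minimal)
  moreover have "inj_on ?p ?E"
  proof (rule inj_onI)
    fix x y assume "x \<in> ?E" "y \<in> ?E" and eq: "x 1 = y 1"
    then have "x - y \<in> ?E" using E by (simp add: vseq.subspace_diff)
    then obtain u where u: "u \<in> kernel r" "x - y = seq u" unfolding mem_op_eigenspace_iff by blast
    have "seq u 1 = 0" using eq by (simp add: u(2)[symmetric])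
    then have "u = 0" using u(1) graph_eigenvector_zero[of u r] by (simp add: kernel_def)
    then show "x = y" using u(2) by (simp add: zero_ell2.rep_eq)
  qed
  ultimately have inj: "inj_on ?p (vseq.span F)" by (rule inj_on_subset[rotated])
  have "vec.independent (?p ` F)"
    using lin F(2) inj by (rule linear_independent_injective_image)
  then have "finite (?p ` F)" by (rule vec.finiteI_independent)
  then have "finite F"
    by (rule finite_imageD) (rule inj_on_subset[OF inj vseq.span_superset])
  then show ?thesis using F(3) by blast
qed

end

text \<open>Summation by parts: taking adjoints moves each subdiagonal term to the bond joining n
  and n + 1. The boundary term at K disappears once v is zero there.\<close>

lemma sum_jacobi_form:
  assumes "v 0 = 0" "w 0 = 0"
  shows "(\<Sum>n<Suc K. inner (jacobi A B v n) (w n))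
    = (\<Sum>n<Suc K. inner (B n *v v n) (w n))
      + (\<Sum>n<K. inner (A n *v v (Suc n)) (w n) + inner (A n *v w (Suc n)) (v n))
      + inner (A K *v v (Suc K)) (w K)"
proof (induction K)
  case (Suc K)
  have "inner (conj_transpose (A K) *v v K) (w (Suc K)) = inner (A K *v w (Suc K)) (v K)"
    by (metis inner_commute inner_conj_transpose)
  then show ?case
    using Suc jacobi_eq[of v "Suc K" A B, OF assms(1)] by (simp add: inner_add_left)
qed (simp add: assms)

text \<open>Each inner index n belongs to the bonds n - 1 and n, whose weights add up to q. The
  weights have period 2, so \<open>t (Suc K)\<close> stands for the weight of the last bond K -
  1.\<close>

lemma sum_coupling_le:
  fixes F t :: "nat \<Rightarrow> real"
  assumes "\<And>n. t n + t (Suc n) = q"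
  shows "(\<Sum>n<K. t n * (F n + F (Suc n))) \<le> q * (\<Sum>n<K. F n) + t (Suc K) * F K - t 1 * F 0"
proof (induction K)
  case (Suc K)
  have "t (Suc (Suc K)) = t K" using assms[of K] assms[of "Suc K"] by linarith
  moreover have "t K * F K + t (Suc K) * F K = q * F K"
    by (simp add: assms distrib_right[symmetric])
  ultimately show ?case using Suc by (simp add: algebra_simps)
qed simp

context jacobi_extension
begin

text \<open>Pairing with \<open>2 P - 1\<close> makes the nonpositive parts of the diagonal blocks contribute with
  the right sign, and the couplings between positive and nonpositive parts cancel.\<close>

lemma tail_lower_bound:
  assumes root: "\<And>n. n > N \<Longrightarrow> positive_root (B n) (P n) (S n)"
    and odd_P: "\<And>n. n > N \<Longrightarrow> odd n \<Longrightarrow> P n = mat 1"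
    and coupling: "\<And>n x x'. n > N \<Longrightarrow> 2 * \<bar>inner (A n *v (P (Suc n) *v x')) (P n *v x)\<bar>
      \<le> (if odd n then a else b) * (inner (B n *v (P n *v x)) (P n *v x)
          + inner (B (Suc n) *v (P (Suc n) *v x')) (P (Suc n) *v x'))"
    and growth: "\<And>n x. n > N \<Longrightarrow>
      2 * r * (norm (P n *v x))\<^sup>2 \<le> (1 - (a + b)) * inner (B n *v (P n *v x)) (P n *v x)"
    and ab: "0 \<le> a" "0 \<le> b" and r: "0 < r"
    and vh: "(v, h) \<in> graph" and fin: "finite {n. seq v n \<noteq> 0}" and v0: "\<And>n. n \<le> N \<Longrightarrow> seq v n = 0"
  shows "r * norm v \<le> norm (h - r *\<^sub>R v)"
proof -
  define t where "t n = (if odd n then a else b)" for n :: nat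
  define p where "p n = P n *v seq v n" for n
  define q where "q n = seq v n - p n" for n
  \<comment> \<open>This is (2 P - 1) v; the reflection preserves the norm, so the final
    Cauchy-Schwarz step loses nothing.\<close>
  define x where "x n = p n - q n" for n
  define F where "F n = inner (B n *v p n) (p n)" for n
  have low: "p n = 0" "q n = 0" "x n = 0" "F n = 0" if "n \<le> N" for n
    using v0[OF that] by (simp_all add: p_def q_def x_def F_def)
  have v: "seq v n = p n + q n" for n by (simp add: q_def)
  have pq: "inner (p n) (q n) = 0" "inner (B n *v p n) (q n) = 0" "inner (B n *v q n) (q n) \<le> 0" "0 \<le> F n" for n
  proof -
    have "inner (p n) (q n) = 0 \<and> inner (B n *v p n) (q n) = 0 \<and> inner (B n *v q n) (q n) \<le> 0 \<and> 0 \<le> F n"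
    proof (cases "n \<le> N")
      case False
      then have R: "positive_root (B n) (P n) (S n)" using root by simp
      have hP: "hermitian (P n)" and Pp: "P n *v p n = p n" and BP: "B n *v p n = P n *v (B n *v seq v n)"
        using R by (simp_all add: positive_root_def p_def)
      have PBp: "P n *v (B n *v p n) = B n *v p n"
        using R by (simp add: positive_root_def BP)
      have Pq: "P n *v q n = 0"
        by (simp add: q_def matrix_vector_mult_diff_distrib Pp p_def[symmetric])
      have "inner (p n) (q n) = 0"
        using hermitian_inner[OF hP, of "p n" "q n"] by (simp add: Pp Pq)
      moreover have "inner (B n *v p n) (q n) = 0"
        using hermitian_inner[OF hP, of "B n *v p n" "q n"] by (simp add: PBp Pq)
      moreover have "inner (B n *v q n) (q n) \<le> 0"
        using R by (simp add: positive_root_def q_def p_def)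
      moreover have "0 \<le> F n"
        using positive_root_norm(2)[OF R, of "seq v n"] by (metis F_def p_def zero_le_power2)
      ultimately show ?thesis by blast
    qed (simp add: low)
    then show "inner (p n) (q n) = 0" "inner (B n *v p n) (q n) = 0" "inner (B n *v q n) (q n) \<le> 0" "0 \<le> F n"
      by blast+
  qed
  have norm_v: "(norm (seq v n))\<^sup>2 = (norm (p n))\<^sup>2 + (norm (q n))\<^sup>2"
    and norm_x: "(norm (x n))\<^sup>2 = (norm (p n))\<^sup>2 + (norm (q n))\<^sup>2"
    and vx: "inner (seq v n) (x n) = (norm (p n))\<^sup>2 - (norm (q n))\<^sup>2" for n
    using pq(1)[of n] by (simp_all add: v x_def power2_norm_eq_inner inner_add_left inner_add_right
        inner_diff_left inner_diff_right inner_commute)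
  have diag: "F n \<le> inner (B n *v seq v n) (x n)" for n
  proof (cases "n \<le> N")
    case False
    then have "inner (B n *v q n) (p n) = 0"
      using hermitian_inner[OF hermitian_B, of n "p n" "q n"] pq(2)[of n] by (simp add: inner_commute)
    then show ?thesis
      using pq(2,3)[of n] by (simp add: v x_def F_def matrix_vector_right_distrib inner_add_left inner_diff_right)
  qed (simp add: low)
  have offdiag: "- (t n * (F n + F (Suc n))) \<le> inner (A n *v seq v (Suc n)) (x n) + inner (A n *v x (Suc n)) (seq v n)" for n
  proof (cases "n \<le> N")
    \<comment> \<open>The bond from N to N + 1 falls here: its coupling is zero, but F (N + 1) may
      be positive, so the signs of a, b and F matter.\<close>
    case True
    then show ?thesis using v0[OF True] low[OF True] pq(4)[of "Suc n"] ab by (auto simp: t_def)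
  next
    case False
    \<comment> \<open>One of two neighbouring indices is odd, and there P = 1. This removes the
      coupling among nonpositive parts, the only one of uncontrolled sign.\<close>
    have "q n = 0 \<or> q (Suc n) = 0"
      using odd_P[of n] odd_P[of "Suc n"] False by (cases "odd n") (auto simp: q_def p_def)
    then have "inner (A n *v q (Suc n)) (q n) = 0" by auto
    then have "inner (A n *v seq v (Suc n)) (x n) + inner (A n *v x (Suc n)) (seq v n)
        = 2 * inner (A n *v p (Suc n)) (p n)"
      by (simp add: v x_def matrix_vector_right_distrib matrix_vector_mult_diff_distrib
          inner_add_left inner_add_right inner_diff_left inner_diff_right)
    moreover have "2 * \<bar>inner (A n *v p (Suc n)) (p n)\<bar> \<le> t n * (F n + F (Suc n))"
      using coupling[of n "seq v (Suc n)" "seq v n"] False by (simp add: p_def F_def t_def)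
    ultimately show ?thesis by linarith
  qed
  obtain K where K: "\<And>n. n \<ge> K \<Longrightarrow> seq v n = 0" "\<And>n. n \<ge> K \<Longrightarrow> jacobi A B (seq v) n = 0" "K \<ge> 1"
    using jacobi_finite_support[of "seq v" A B, OF seq_0 fin] by blast
  have highK: "p n = 0" "q n = 0" "x n = 0" "F n = 0" if "n \<ge> K" for n
    using K(1)[OF that] by (simp_all add: p_def q_def x_def F_def)
  have x0: "x 0 = 0" using low by simp
  have "(\<Sum>n<K. t n * (F n + F (Suc n))) \<le> (a + b) * (\<Sum>n<K. F n)"
    using sum_coupling_le[of t "a + b" F K] low[of 0] highK[of K] by (simp add: t_def)
  then have "(1 - (a + b)) * (\<Sum>n<Suc K. F n) \<le> (\<Sum>n<Suc K. F n) + (\<Sum>n<K. - (t n * (F n + F (Suc n))))"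
    using highK[of K] by (simp add: sum_negf left_diff_distrib)
  also have "\<dots> \<le> (\<Sum>n<Suc K. inner (B n *v seq v n) (x n))
      + (\<Sum>n<K. inner (A n *v seq v (Suc n)) (x n) + inner (A n *v x (Suc n)) (seq v n))"
    by (intro add_mono sum_mono diag offdiag)
  also have "\<dots> = (\<Sum>n<Suc K. inner (jacobi A B (seq v) n) (x n))"
    using sum_jacobi_form[of "seq v" x A B K, OF seq_0 x0] K(1)[of "Suc K"] by simp
  finally have form: "(1 - (a + b)) * (\<Sum>n<Suc K. F n) \<le> (\<Sum>n<Suc K. inner (jacobi A B (seq v) n) (x n))" .
  have "summable (\<lambda>n. (norm (x n))\<^sup>2)"
    by (rule summable_finite[of "{..<K}"]) (simp_all add: highK)
  then have "x \<in> l2"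
    by (simp add: l2_def x0)
  then obtain w where w: "seq w = x" using seq_eqI by blast
  have nw: "norm w = norm v"
  proof -
    have "(\<lambda>n. (norm (seq w n))\<^sup>2) sums (norm v)\<^sup>2"
      using norm_ell2_sums[of v] by (simp add: w norm_x norm_v)
    then have "(norm w)\<^sup>2 = (norm v)\<^sup>2" using norm_ell2_sums[of w] sums_unique2 by blast
    then show ?thesis by simp
  qed
  have sums: "inner f w = (\<Sum>n<Suc K. inner (seq f n) (x n))" for f
  proof -
    have "(\<lambda>n. inner (seq f n) (seq w n)) sums (\<Sum>n<Suc K. inner (seq f n) (seq w n))"
      by (rule sums_finite) (auto simp: w highK)
    then show ?thesis using inner_ell2_sums[of f w] sums_unique2 w by metis
  qed
  have "inner h w = (\<Sum>n<Suc K. inner (jacobi A B (seq v) n) (x n))"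
    unfolding sums
  proof (intro sum.cong refl)
    fix n show "inner (seq h n) (x n) = inner (jacobi A B (seq v) n) (x n)"
      using graph_jacobi[OF vh, of n] x0 by (cases "n = 0") auto
  qed
  then have hw: "(1 - (a + b)) * (\<Sum>n<Suc K. F n) \<le> inner h w" using form by simp
  have vw: "inner v w = (\<Sum>n<Suc K. (norm (p n))\<^sup>2 - (norm (q n))\<^sup>2)"
    unfolding sums vx ..
  have vv: "(norm v)\<^sup>2 = (\<Sum>n<Suc K. (norm (p n))\<^sup>2 + (norm (q n))\<^sup>2)"
  proof -
    have "(\<lambda>n. (norm (seq v n))\<^sup>2) sums (\<Sum>n<Suc K. (norm (seq v n))\<^sup>2)"
      by (rule sums_finite) (auto simp: K)
    then show ?thesis using norm_ell2_sums[of v] sums_unique2 norm_v by (metis (no_types, lifting) sum.cong)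
  qed
  \<comment> \<open>Of the 2 r granted to the positive part, one r compensates the shift by r, the
    other survives in the bound.\<close>
  have "2 * r * (norm (p n))\<^sup>2 \<le> (1 - (a + b)) * F n" for n
    using growth[of n "seq v n"] low[of n] by (cases "n \<le> N") (auto simp: p_def F_def)
  then have "(\<Sum>n<Suc K. 2 * r * (norm (p n))\<^sup>2) \<le> (\<Sum>n<Suc K. (1 - (a + b)) * F n)"
    by (rule sum_mono)
  also have "\<dots> \<le> inner h w"
    using hw by (simp only: sum_distrib_left)
  finally have "(\<Sum>n<Suc K. 2 * r * (norm (p n))\<^sup>2) - r * inner v w \<le> inner (h - r *\<^sub>R v) w"
    by (simp add: inner_diff_left)
  moreover have "(\<Sum>n<Suc K. 2 * r * (norm (p n))\<^sup>2) - r * inner v w = r * (norm v)\<^sup>2"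
    unfolding vw vv by (simp add: sum_distrib_left sum_subtractf[symmetric] algebra_simps del: sum.lessThan_Suc)
  moreover have "inner (h - r *\<^sub>R v) w \<le> norm (h - r *\<^sub>R v) * norm v"
    using norm_cauchy_schwarz[of "h - r *\<^sub>R v" w] by (simp add: nw)
  ultimately have "(r * norm v) * norm v \<le> norm (h - r *\<^sub>R v) * norm v"
    by (simp add: power2_eq_square mult_ac)
  then show ?thesis
    by (cases "v = 0") (auto simp: mult_le_cancel_right)
qed

text \<open>The range of \<open>J - r\<close> on finitely supported sequences living beyond \<open>N\<close> has a
  finite-dimensional orthogonal complement, because the recurrence determines its elements from their
  first \<open>N + 1\<close> components. Subtracting the part of \<open>u\<close> produced by this range leaves a
  finite-dimensional space.\<close>

lemma apriori_estimate:
  assumes r: "0 < r"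
    and tail: "\<And>v h. (v, h) \<in> graph \<Longrightarrow> finite {n. seq v n \<noteq> 0} \<Longrightarrow> (\<And>n. n \<le> N \<Longrightarrow> seq v n = 0)
      \<Longrightarrow> r * norm v \<le> norm (h - r *\<^sub>R v)"
  shows "\<exists>C\<ge>0. \<exists>M. \<forall>(u, f)\<in>graph. norm u \<le> C * (norm (f - r *\<^sub>R u) + (\<Sum>n<M. norm (seq u n)))"
proof -
  define D where "D = {(v, h) \<in> graph. finite {n. seq v n \<noteq> 0} \<and> (\<forall>n\<le>N. seq v n = 0)}"
  define R where "R = {h - r *\<^sub>R v |v h. (v, h) \<in> D}"
  have D_add: "(v + v', h + h') \<in> D" if "(v, h) \<in> D" "(v', h') \<in> D" for v h v' h'
  proof -
    have "finite {n. seq (v + v') n \<noteq> 0}"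
      by (rule finite_subset[of _ "{n. seq v n \<noteq> 0} \<union> {n. seq v' n \<noteq> 0}"])
        (use that in \<open>auto simp: D_def seq_simps\<close>)
    then show ?thesis using that unfolding D_def by (auto simp: graph_add seq_simps)
  qed
  have D_scale: "(c *\<^sub>R v, c *\<^sub>R h) \<in> D" if "(v, h) \<in> D" for c v h
  proof -
    have "finite {n. seq (c *\<^sub>R v) n \<noteq> 0}"
      by (rule finite_subset[of _ "{n. seq v n \<noteq> 0}"]) (use that in \<open>auto simp: D_def seq_simps\<close>)
    then show ?thesis using that unfolding D_def by (auto simp: graph_scaleR seq_simps)
  qed
  have "(0, 0) \<in> D" by (simp add: D_def graph_zero seq_simps)
  then have subR: "subspace R"
  proof (intro subspaceI)
    have "0 = 0 - r *\<^sub>R (0 :: 'd ell2)" by simp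
    with \<open>(0, 0) \<in> D\<close> show "0 \<in> R" unfolding R_def by blast
    show "x + y \<in> R" if xy: "x \<in> R" "y \<in> R" for x y
    proof -
      obtain v h v' h' where *: "(v, h) \<in> D" "(v', h') \<in> D" "x = h - r *\<^sub>R v" "y = h' - r *\<^sub>R v'"
        using xy unfolding R_def by blast
      have "x + y = (h + h') - r *\<^sub>R (v + v')" by (simp add: *(3,4) algebra_simps)
      then show ?thesis unfolding R_def using D_add[OF *(1,2)] by blast
    qed
    show "c *\<^sub>R x \<in> R" if x: "x \<in> R" for c x
    proof -
      obtain v h where *: "(v, h) \<in> D" "x = h - r *\<^sub>R v"
        using x unfolding R_def by blast
      have "c *\<^sub>R x = (c *\<^sub>R h) - r *\<^sub>R (c *\<^sub>R v)" by (simp add: *(2) algebra_simps)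
      then show ?thesis unfolding R_def using D_scale[OF *(1)] by blast
    qed
  qed
  have D_bound: "r * norm v \<le> norm (h - r *\<^sub>R v)" if "(v, h) \<in> D" for v h
    using tail[of v h] that by (simp add: D_def)
  have D_diff: "(v - v', h - h') \<in> D" if "(v, h) \<in> D" "(v', h') \<in> D" for v h v' h'
    using D_add[OF that(1) D_scale[OF that(2), of "-1"]] by simp
  \<comment> \<open>Since J - r is bounded below on D, preimages of a convergent sequence in R
    converge, and the closed graph contains the limit.\<close>
  have solve: "\<exists>v. (v, g + r *\<^sub>R v) \<in> graph \<and> r * norm v \<le> norm g" if g: "g \<in> closure R" for g
  proof -
    obtain \<rho> where \<rho>: "\<And>n. \<rho> n \<in> R" "\<rho> \<longlonglongrightarrow> g"
      using g unfolding closure_sequential by blast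
    have "\<forall>n. \<exists>v. (v, \<rho> n + r *\<^sub>R v) \<in> D"
    proof
      fix n
      obtain v h where "(v, h) \<in> D" "\<rho> n = h - r *\<^sub>R v" using \<rho>(1)[of n] unfolding R_def by blast
      then show "\<exists>v. (v, \<rho> n + r *\<^sub>R v) \<in> D" by (intro exI[of _ v]) simp
    qed
    then obtain v where v: "\<And>n. (v n, \<rho> n + r *\<^sub>R v n) \<in> D" by metis
    have "Cauchy v"
    proof (rule Cauchy_if_norm_diff_le_null)
      fix m n
      have "r * norm (v m - v n) \<le> norm (\<rho> m - \<rho> n)"
        using D_bound[OF D_diff[OF v[of m] v[of n]]] by (simp add: algebra_simps)
      also have "\<dots> \<le> norm (\<rho> m - g) + norm (\<rho> n - g)"
        using norm_triangle_ineq4[of "\<rho> m - g" "\<rho> n - g"] by simp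
      finally show "norm (v m - v n) \<le> norm (\<rho> m - g) / r + norm (\<rho> n - g) / r"
        using r by (simp add: field_simps)
    next
      have "(\<lambda>n. norm (\<rho> n - g)) \<longlonglongrightarrow> 0"
        using \<rho>(2) by (simp add: LIM_zero_iff tendsto_norm_zero_iff)
      then show "(\<lambda>n. norm (\<rho> n - g) / r) \<longlonglongrightarrow> 0"
        by (rule tendsto_divide_zero)
    qed
    then obtain y where y: "v \<longlonglongrightarrow> y"
      using Cauchy_convergent[of v] unfolding convergent_def by blast
    have T: "(v n, \<rho> n + r *\<^sub>R v n) \<in> graph" for n using v[of n] by (simp add: D_def)
    have "(y, g + r *\<^sub>R y) \<in> graph"
      by (rule graph_limit[OF T y tendsto_add[OF \<rho>(2) tendsto_scaleR[OF tendsto_const y]]])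
    moreover have "r * norm y \<le> norm g"
    proof (rule LIMSEQ_le)
      show "(\<lambda>n. r * norm (v n)) \<longlonglongrightarrow> r * norm y"
        by (rule tendsto_mult[OF tendsto_const tendsto_norm[OF y]])
      show "(\<lambda>n. norm (\<rho> n)) \<longlonglongrightarrow> norm g"
        by (rule tendsto_norm[OF \<rho>(2)])
      show "\<exists>M. \<forall>n\<ge>M. r * norm (v n) \<le> norm (\<rho> n)"
        using D_bound[OF v] by simp
    qed
    ultimately show ?thesis by blast
  qed
  \<comment> \<open>Single-index vectors beyond N belong to D, so orthogonality to R is the
    eigenvalue equation there.\<close>
  have orth_jacobi: "jacobi A B (seq s) n = r *\<^sub>R seq s n"
    if s: "\<And>x. x \<in> R \<Longrightarrow> inner s x = 0" and n: "n > N" for s n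
  proof -
    have "inner e (jacobi A B (seq s) n - r *\<^sub>R seq s n) = 0" for e
    proof -
      have n1: "n \<ge> 1" using n by simp
      obtain d h where d: "(d, h) \<in> graph" "seq d = (\<lambda>j. if j = n then e else 0)"
        "\<And>v. inner d v = inner e (seq v n)" "\<And>v. inner h v = inner e (jacobi A B (seq v) n)"
        by (rule delta_in_graph[OF n1, of e]) blast
      have "finite {j. seq d j \<noteq> 0}"
        unfolding d(2) by (rule finite_subset[of _ "{n}"]) auto
      then have "(d, h) \<in> D" using d(1) n by (simp add: D_def d(2))
      then have "h - r *\<^sub>R d \<in> R" unfolding R_def by blast
      from s[OF this] show ?thesis
        by (simp add: inner_commute[of s] inner_diff_left inner_diff_right d(3,4))
    qed
    then show ?thesis by (metis eq_iff_diff_eq_0 inner_eq_zero_iff)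
  qed
  \<comment> \<open>The domain vectors w for which s = (J - r) w is orthogonal to R.\<close>
  define W where "W = {w. \<exists>s. (w, s + r *\<^sub>R w) \<in> graph \<and> (\<forall>x\<in>R. inner s x = 0)}"
  have subW: "subspace W"
  proof (rule subspaceI)
    show "0 \<in> W" unfolding W_def using graph_zero by (auto intro!: exI[of _ 0])
    show "x + y \<in> W" if xy: "x \<in> W" "y \<in> W" for x y
    proof -
      obtain s s' where *: "(x, s + r *\<^sub>R x) \<in> graph" "\<forall>z\<in>R. inner s z = 0"
        "(y, s' + r *\<^sub>R y) \<in> graph" "\<forall>z\<in>R. inner s' z = 0"
        using xy unfolding W_def by blast
      have "(x + y, (s + s') + r *\<^sub>R (x + y)) \<in> graph"
        using graph_add[OF *(1,3)] by (simp add: algebra_simps)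
      moreover have "\<forall>z\<in>R. inner (s + s') z = 0" using * by (simp add: inner_add_left)
      ultimately show ?thesis unfolding W_def by blast
    qed
    show "c *\<^sub>R x \<in> W" if x: "x \<in> W" for c x
    proof -
      obtain s where *: "(x, s + r *\<^sub>R x) \<in> graph" "\<forall>z\<in>R. inner s z = 0"
        using x unfolding W_def by blast
      have "(c *\<^sub>R x, (c *\<^sub>R s) + r *\<^sub>R (c *\<^sub>R x)) \<in> graph"
        using graph_scaleR[OF *(1), of c] by (simp add: algebra_simps)
      moreover have "\<forall>z\<in>R. inner (c *\<^sub>R s) z = 0" using * by simp
      ultimately show ?thesis unfolding W_def by blast
    qed
  qed
  \<comment> \<open>The recurrence at n = N + 1 reads w up to N + 2, hence N + 3 components: their
    vanishing makes s zero up to N + 1, continuation gives s = 0, and w is an eigenvector with first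
    component zero.\<close>
  have sep: "w = 0" if w: "w \<in> W" "\<And>n. n < N + 3 \<Longrightarrow> seq w n = 0" for w
  proof -
    obtain s where s: "(w, s + r *\<^sub>R w) \<in> graph" "\<And>x. x \<in> R \<Longrightarrow> inner s x = 0"
      using w(1) unfolding W_def by blast
    have rec: "jacobi A B (seq w) n = seq s n + r *\<^sub>R seq w n" if "n \<ge> 1" for n
      using graph_jacobi[OF s(1) that] by (simp add: seq_simps)
    have s0: "seq s n = 0" if "n \<le> Suc N" for n
    proof (cases "n = 0")
      case False
      then have "jacobi A B (seq w) n = 0"
        using jacobi_eq[of "seq w" n A B, OF seq_0] w(2)[of n] w(2)[of "n - 1"] w(2)[of "Suc n"] that by simp
      then show ?thesis using rec[of n] False w(2)[of n] that by simp
    qed (simp add: seq_0)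
    have "seq s n = 0" for n
      by (rule jacobi_unique_continuation[OF invertible_A s0 orth_jacobi[OF s(2)]])
    then have "s = 0" by (intro ell2_eqI) (simp add: seq_simps)
    then show "w = 0"
      using s(1) w(2)[of 1] by (intro graph_eigenvector_zero[of w r]) auto
  qed
  have "\<exists>C\<ge>0. \<forall>w\<in>W. norm w \<le> C * (\<Sum>n<N+3. norm (seq w n))"
    by (rule norm_le_coordinates[where \<phi> = "\<lambda>n w. seq w n",
          OF bounded_linear.linear[OF bounded_linear_seq] subW sep])
  then obtain C where C: "C \<ge> 0" "\<And>w. w \<in> W \<Longrightarrow> norm w \<le> C * (\<Sum>n<N+3. norm (seq w n))"
    by blast
  \<comment> \<open>1 / r pays for v. The remainder u - v costs C times its N + 3 components, and
    each component of v is at most |g| / r.\<close>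
  define C' where "C' = 1 / r + C * (1 + real (N + 3) / r)"
  have "norm u \<le> C' * (norm (f - r *\<^sub>R u) + (\<Sum>n<N+3. norm (seq u n)))" if uf: "(u, f) \<in> graph" for u f
  proof -
    define g where "g = f - r *\<^sub>R u"
    let ?s = "\<Sum>n<N+3. norm (seq u n)"
    obtain \<rho> where \<rho>: "\<rho> \<in> closure R" "\<And>z. z \<in> closure R \<Longrightarrow> inner (g - \<rho>) z = 0"
      using orthogonal_projection_exists[of "closure R" g] subspace_closure[OF subR] by auto
    obtain v where v: "(v, \<rho> + r *\<^sub>R v) \<in> graph" "r * norm v \<le> norm \<rho>"
      using solve[OF \<rho>(1)] by blast
    have "norm \<rho> \<le> norm g"
    proof -
      have "inner \<rho> \<rho> = inner g \<rho>" using \<rho>(2)[OF \<rho>(1)] by (simp add: inner_diff_left)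
      then have "norm \<rho> * norm \<rho> \<le> norm g * norm \<rho>"
        using norm_cauchy_schwarz[of g \<rho>] by (simp add: dot_square_norm power2_eq_square)
      then show ?thesis by (cases "\<rho> = 0") (auto simp: mult_le_cancel_right)
    qed
    then have nv: "norm v \<le> norm g / r" using v(2) r by (simp add: field_simps)
    have "(u - v, (g - \<rho>) + r *\<^sub>R (u - v)) \<in> graph"
      using graph_diff[OF uf v(1)] by (simp add: g_def algebra_simps)
    moreover have "\<forall>x\<in>R. inner (g - \<rho>) x = 0"
      using \<rho>(2) closure_subset by blast
    ultimately have "u - v \<in> W" unfolding W_def by blast
    then have "norm (u - v) \<le> C * (\<Sum>n<N+3. norm (seq (u - v) n))" by (rule C(2))
    also have "\<dots> \<le> C * (\<Sum>n<N+3. norm (seq u n) + norm g / r)"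
    proof (intro mult_left_mono sum_mono C(1))
      fix n
      have "norm (seq (u - v) n) \<le> norm (seq u n) + norm (seq v n)"
        by (simp add: seq_simps norm_triangle_ineq4)
      then show "norm (seq (u - v) n) \<le> norm (seq u n) + norm g / r"
        using norm_seq_le[of v n] nv by linarith
    qed
    also have "\<dots> = C * ?s + C * (real (N + 3) / r) * norm g"
      by (simp add: sum.distrib distrib_left distrib_right add_divide_distrib)
    finally have "norm u \<le> norm g / r + C * ?s + C * (real (N + 3) / r) * norm g"
      using norm_triangle_ineq[of "u - v" v] nv by simp
    also have "\<dots> \<le> C' * ?s + C' * norm g"
    proof -
      have "C * ?s \<le> C' * ?s"
        using r C(1) by (intro mult_right_mono) (auto simp: C'_def algebra_simps sum_nonneg)
      moreover have "(1 / r + C * (real (N + 3) / r)) * norm g \<le> C' * norm g"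
        using C(1) by (intro mult_right_mono) (auto simp: C'_def distrib_left)
      ultimately show ?thesis by (simp add: distrib_right)
    qed
    finally show ?thesis by (simp add: g_def algebra_simps)
  qed
  moreover have "C' \<ge> 0" using r C(1) by (simp add: C'_def)
  ultimately show ?thesis by blast
qed

text \<open>The threshold N may depend on r, because isolation and multiplicity are checked at one
  spectral point at a time.\<close>

lemma discrete_spectrum_in_if_tail_lower_bound:
  assumes tail: "\<And>r. 0 < r \<Longrightarrow> \<exists>N. \<forall>(v, h)\<in>graph. finite {n. seq v n \<noteq> 0} \<longrightarrow> (\<forall>n\<le>N. seq v n = 0)
      \<longrightarrow> r * norm v \<le> norm (h - r *\<^sub>R v)"
  shows "discrete_spectrum_in J {0<..}"
  unfolding discrete_spectrum_in_def
proof (intro ballI)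
  fix z assume "z \<in> op_spectrum J \<inter> complex_of_real ` {0<..}"
  then obtain r where r: "0 < r" "z = complex_of_real r" and spec: "complex_of_real r \<in> op_spectrum J"
    by auto
  obtain N where N: "\<And>v h. (v, h) \<in> graph \<Longrightarrow> finite {n. seq v n \<noteq> 0} \<Longrightarrow> (\<And>n. n \<le> N \<Longrightarrow> seq v n = 0)
      \<Longrightarrow> r * norm v \<le> norm (h - r *\<^sub>R v)"
    using tail[OF r(1)] by blast
  obtain C M where C: "0 \<le> C"
    and apriori: "\<And>u f. (u, f) \<in> graph \<Longrightarrow> norm u \<le> C * (norm (f - r *\<^sub>R u) + (\<Sum>n<M. norm (seq u n)))"
    using apriori_estimate[OF r(1) N] by blast
  show "z isolated_in op_spectrum J \<and> op_eigenspace J z \<noteq> {0} \<and>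
      (\<exists>F. finite F \<and> op_eigenspace J z \<subseteq> vseq.span F)"
    unfolding r(2)
    using spectrum_isolated_eigenvalue[where \<phi> = "\<lambda>n u. seq u n", OF bounded_linear_seq C apriori spec]
      finite_dim_op_eigenspace by blast
qed

end


subsection \<open>The asymptotic conditions\<close>

text \<open>Nonnegativity and the bound on the sum make both limits superior finite. The remaining
  room below 1 is split into thirds: one for each bound, one to keep the inequality strict.\<close>

lemma limsup_add_less_oneE:
  fixes x y :: "nat \<Rightarrow> real"
  assumes nonneg: "\<And>n. 0 \<le> x n" "\<And>n. 0 \<le> y n"
    and less: "limsup (\<lambda>n. ereal (x n)) + limsup (\<lambda>n. ereal (y n)) < 1"
  obtains a b N where "0 \<le> a" "0 \<le> b" "a + b < 1" "\<And>n. n \<ge> N \<Longrightarrow> x n \<le> a" "\<And>n. n \<ge> N \<Longrightarrow> y n \<le> b"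
proof -
  have ge: "0 \<le> limsup (\<lambda>n. ereal (x n))" "0 \<le> limsup (\<lambda>n. ereal (y n))"
    using nonneg by (auto intro!: le_Limsup)
  obtain a' b' where ab': "limsup (\<lambda>n. ereal (x n)) = ereal a'" "limsup (\<lambda>n. ereal (y n)) = ereal b'"
    using ge less by (cases "limsup (\<lambda>n. ereal (x n))"; cases "limsup (\<lambda>n. ereal (y n))") auto
  have nn: "0 \<le> a'" "0 \<le> b'" "a' + b' < 1" using ge less by (auto simp: ab')
  define d where "d = (1 - (a' + b')) / 3"
  have d: "d > 0" "(a' + d) + (b' + d) < 1" using nn by (auto simp: d_def field_simps)
  have "eventually (\<lambda>n. ereal (x n) < ereal (a' + d)) sequentially"
    using d by (intro Limsup_lessD) (simp add: ab')
  moreover have "eventually (\<lambda>n. ereal (y n) < ereal (b' + d)) sequentially"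
    using d by (intro Limsup_lessD) (simp add: ab')
  ultimately have "eventually (\<lambda>n. x n \<le> a' + d \<and> y n \<le> b' + d) sequentially"
    by eventually_elim auto
  then obtain N where "\<And>n. n \<ge> N \<Longrightarrow> x n \<le> a' + d \<and> y n \<le> b' + d"
    unfolding eventually_sequentially by blast
  then show ?thesis using nn d by (intro that[of "a' + d" "b' + d" N]) auto
qed

theorem theoremB:
  fixes A B :: "nat \<Rightarrow> complex^'d^'d" and J :: "'d::finite seq_op"
  assumes "\<And>n. n \<ge> 1 \<Longrightarrow> hermitian (B n)"
    and "\<And>n. n \<ge> 1 \<Longrightarrow> invertible (A n)"
    and "defect_number (jacobi_min A B) \<i> = defect_number (jacobi_min A B) (- \<i>)"
    and "self_adjoint J" and "jacobi_min A B \<subseteq> J"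
    and "tends_to_pinfty (\<lambda>k. B (2 * k - 1))"
    and "(\<lambda>k. pos_inv (B (2 * k))) \<longlonglongrightarrow> 0"
    and "limsup (\<lambda>n. ereal (matrix_norm
             (pos_inv_sqrt (B (2 * n)) ** conj_transpose (A (2 * n - 1)) ** inv_sqrt (B (2 * n - 1)))))
         + limsup (\<lambda>n. ereal (matrix_norm
             (pos_inv_sqrt (B (2 * n - 2)) ** A (2 * n - 2) ** inv_sqrt (B (2 * n - 1))))) < 1"
  shows "discrete_spectrum_in J {0<..}"
proof -
  interpret jacobi_extension J A B
    by unfold_locales (fact assms(4), erule assms(1), erule assms(2), fact assms(5))
  show ?thesis
  proof (rule discrete_spectrum_in_if_tail_lower_bound)
    fix r :: real assume r: "0 < r"
    obtain a b N1 where ab: "0 \<le> a" "0 \<le> b" "a + b < 1"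
      and N1: "\<And>n. n \<ge> N1 \<Longrightarrow> matrix_norm
          (pos_inv_sqrt (B (2 * n)) ** conj_transpose (A (2 * n - 1)) ** inv_sqrt (B (2 * n - 1))) \<le> a"
        "\<And>n. n \<ge> N1 \<Longrightarrow> matrix_norm
          (pos_inv_sqrt (B (2 * n - 2)) ** A (2 * n - 2) ** inv_sqrt (B (2 * n - 1))) \<le> b"
      using limsup_add_less_oneE[OF matrix_norm_nonneg matrix_norm_nonneg assms(8)] by metis
    \<comment> \<open>Chosen so that the share 1 - (a + b) of a diagonal form bounded below by c
      still gives 2 r.\<close>
    define c where "c = 2 * r / (1 - (a + b))"
    have c: "0 < c" "(1 - (a + b)) * c = 2 * r" using r ab by (simp_all add: c_def)
    obtain N2 where N2: "\<And>k. k \<ge> N2 \<Longrightarrow> pos_semidef (B (2 * k - 1) - mat (complex_of_real c))"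
      using assms(6) c(1) unfolding tends_to_pinfty_def by (meson less_imp_le)
    have "eventually (\<lambda>k. matrix_norm (pos_inv (B (2 * k))) < 1 / c) sequentially"
      using tendsto_matrix_norm[OF assms(7)] c(1) by (intro order_tendstoD(2)) auto
    then obtain N3 where N3: "\<And>k. k \<ge> N3 \<Longrightarrow> matrix_norm (pos_inv (B (2 * k))) \<le> 1 / c"
      unfolding eventually_sequentially by (meson less_imp_le)
    \<comment> \<open>The factor 2 converts thresholds for the half index k into one for n.\<close>
    define N where "N = 2 * (N1 + N2 + N3)"
    define P where "P n = (if odd n then mat 1 else spectral_proj (B n) {0<..})" for n :: nat
    define S where "S n = (if odd n then inv_sqrt (B n) else pos_inv_sqrt (B n))" for n :: nat
    have pos: "pos_semidef (B n - mat (complex_of_real c))" if n: "n > N" "odd n" for n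
    proof -
      obtain k where "n = 2 * k + 1" using n(2) by (elim oddE)
      \<comment> \<open>The odd index 2 k + 1 is 2 (k + 1) - 1, so \<open>Suc k\<close> is the right
        half index and avoids truncated subtraction.\<close>
      then show ?thesis using N2[of "Suc k"] n(1) by (simp add: N_def)
    qed
    have root: "positive_root (B n) (P n) (S n)" if "n > N" for n
      using positive_root_pos_inv_sqrt(1)[OF assms(1), of n] that
        positive_root_inv_sqrt[OF assms(1) pos c(1), of n] by (auto simp: P_def S_def)
    have coupling: "2 * \<bar>inner (A n *v (P (Suc n) *v x')) (P n *v x)\<bar>
      \<le> (if odd n then a else b) * (inner (B n *v (P n *v x)) (P n *v x)
          + inner (B (Suc n) *v (P (Suc n) *v x')) (P (Suc n) *v x'))" if n: "n > N" for n x x'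
    proof (cases "odd n")
      case True
      then obtain k where k: "n = 2 * k + 1" by (elim oddE)
      \<comment> \<open>The assumption places the even index on the left, so n and n + 1 exchange
        roles and the adjoint of A n appears.\<close>
      have "matrix_norm (S (Suc n) ** conj_transpose (A n) ** S n) \<le> a"
        using N1(1)[of "Suc k"] n by (simp add: S_def k N_def)
      from positive_root_coupling[OF root root this, where x = x' and x' = x] n
      have "2 * \<bar>inner (conj_transpose (A n) *v (P n *v x)) (P (Suc n) *v x')\<bar>
        \<le> a * (inner (B n *v (P n *v x)) (P n *v x)
          + inner (B (Suc n) *v (P (Suc n) *v x')) (P (Suc n) *v x'))"
        by (simp add: add.commute)
      then show ?thesis
        using True inner_conj_transpose[of "A n" "P (Suc n) *v x'" "P n *v x"] by (simp add: inner_commute)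
    next
      case False
      then obtain k where k: "n = 2 * k" by auto
      have "matrix_norm (S n ** A n ** S (Suc n)) \<le> b"
        using N1(2)[of "Suc k"] n by (simp add: S_def k N_def)
      from positive_root_coupling[OF root root this, where x = x and x' = x'] n False
      show ?thesis by simp
    qed
    have growth: "2 * r * (norm (P n *v x))\<^sup>2 \<le> (1 - (a + b)) * inner (B n *v (P n *v x)) (P n *v x)"
      if n: "n > N" for n x
    proof -
      have "c * (norm (P n *v x))\<^sup>2 \<le> inner (B n *v (P n *v x)) (P n *v x)"
      proof (cases "odd n")
        case True
        then show ?thesis using inner_ge_of_pos_semidef_diff[OF pos[OF n]] by blast
      next
        case False
        then obtain k where k: "n = 2 * k" by auto
        \<comment> \<open>On even indices growth of the positive part comes from the vanishing
          positive inverse, on odd ones from B n itself.\<close>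
        have "S n ** S n = pos_inv (B n)"
          using positive_root_pos_inv_sqrt(2)[OF assms(1), of n] n False by (simp add: S_def)
        then have "matrix_norm (S n ** S n) \<le> 1 / c"
          using N3[of k] n by (simp add: k N_def)
        from positive_root_norm_le[OF root[OF n] this, of x] show ?thesis
          using c(1) by (simp add: field_simps)
      qed
      then have "(1 - (a + b)) * (c * (norm (P n *v x))\<^sup>2) \<le> (1 - (a + b)) * inner (B n *v (P n *v x)) (P n *v x)"
        using ab by (intro mult_left_mono) auto
      then show ?thesis by (simp only: mult.assoc[symmetric] c(2))
    qed
    have "r * norm v \<le> norm (h - r *\<^sub>R v)"
      if "(v, h) \<in> graph" "finite {n. seq v n \<noteq> 0}" "\<forall>n\<le>N. seq v n = 0" for v h
      by (rule tail_lower_bound[OF root _ coupling growth ab(1,2) r that(1,2)]) (use that(3) in \<open>auto simp: P_def\<close>)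
    then show "\<exists>N. \<forall>(v, h)\<in>graph. finite {n. seq v n \<noteq> 0} \<longrightarrow> (\<forall>n\<le>N. seq v n = 0)
      \<longrightarrow> r * norm v \<le> norm (h - r *\<^sub>R v)"
      by blast
  qed
qed

end
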